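(* Let $\zeta\in\mathbb{C}$ with $\operatorname{Re}\zeta>0$, let $\eta_1,\eta_2>0$ and $\eta_3\in(0,1)$, let $c\in\mathbb{R}^3$ with $\|c\|=1$, and let $t,s$ be clusters with axis-parallel bounding boxes $B_t,B_s\subset\mathbb{R}^3$ with centers $M_t,M_s$ such that the following three admissibility conditions hold: $$|\operatorname{Im}\zeta|\left\|\frac{M_t-M_s}{\|M_t-M_s\|}-c\right\|\le\frac{\eta_1}{\max\{\operatorname{diam}(B_t),\operatorname{diam}(B_s)\}},$$ $$\max\{\operatorname{diam}(B_t),\operatorname{diam}(B_s)\}\le\eta_2\operatorname{dist}(B_t,B_s),$$ $$|\operatorname{Im}\zeta|\max\{\operatorname{diam}^2(B_t),\operatorname{diam}^2(B_s)\}\le\max\{\eta_2,\ \eta_3(\operatorname{Re}\zeta)\operatorname{dist}(B_t,B_s)\}\operatorname{dist}(B_t,B_s).$$ Then, for every $m\in\mathbb{N}$, $$\sup_{(x,y)\in B_t\times B_s}\left|G(\zeta,x-y)-\tilde G_{t,s}(x,y)\right|\le\frac{C_0\,e^{-\sigma(\operatorname{Re}\zeta)\operatorname{dist}(B_t,B_s)}}{4\pi\operatorname{dist}(B_t,B_s)}\,\rho_0^{-m}\qquad\text{with }\sigma:=\frac{1-\eta_3}{2},$$ where $\tilde G_{t,s}$ is the directional Chebyshev interpolant of degree $m$ and $C_0>0$, $\rho_0>1$ (depending on $\eta_2,\eta_3$) are the constants, all defined in the context.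
   Context: $\|\cdot\|$ is the Euclidean norm on $\mathbb{R}^3$, $\langle\cdot,\cdot\rangle$ the standard inner product on $\mathbb{R}^3$. The boxes $B_t,B_s$ are axis-parallel with positive side lengths; $M_t,M_s$ are their barycenters. Kernel: $G(\zeta,z):=\dfrac{e^{-\zeta\|z\|}}{4\pi\|z\|}$ for $z\in\mathbb{R}^3\setminus\{0\}$. For the unit vector $c$, set $$G_c(z):=e^{-(\operatorname{Re}\zeta)\|z\|}\,\frac{e^{-i(\operatorname{Im}\zeta)(\|z\|-\langle z,c\rangle)}}{4\pi\|z\|},\qquad\text{so that }G(\zeta,z)=e^{-i(\operatorname{Im}\zeta)\langle z,c\rangle}G_c(z).$$ The approximation on $B_t\times B_s$ is $$\tilde G_{t,s}(x,y):=e^{-i(\operatorname{Im}\zeta)\langle x-y,c\rangle}\,\bigl(\mathfrak{I}_{t\times s}[(x',y')\mapsto G_c(x'-y')]\bigr)(x,y),$$ where $\mathfrak{I}_{t\times s}$ is tensor-product Chebyshev interpolation on the six-dimensional box $B_t\times B_s$ with polynomials of degree at most $m$ in each of the six variables (nodes: the $m+1$ Chebyshev points of $(-1,1)$, affinely transformed to each side of the boxes). Constants: $\Lambda_m$ is the Lebesgue constant of univariate Chebyshev interpolation of degree $m$ (at $m+1$ Chebyshev points) on $[-1,1]$; it satisfies $\Lambda_m\le\frac{2}{\pi}\log(m+1)+1$. Further $$\widehat\beta:=\min\left\{1,\ \left(\sqrt{\tfrac32}-1\right)\frac{2}{\eta_2},\ \frac{2(1-\eta_3)}{\eta_2^2(2\sqrt6+5)}\right\},\qquad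 \rho_0:=1+\widehat\beta,\qquad \alpha:=\frac{\sqrt{\widehat\beta^2+1}+\widehat\beta}{\widehat\beta+1}>1,$$ $$C_1:=e^{\eta_1}\sup\left\{\frac{8(\Lambda_m+1)}{(\rho_0-1)\alpha^{m/2}}:m\in\mathbb{N}\right\},\qquad C_0:=\sup\left\{6\,\frac{\Lambda_m^5}{\alpha^{m/2}}\,C_1:m\in\mathbb{N}\right\}.$$ *)

theory Defs
  imports "HOL-Analysis.Analysis"
begin

text \<open>The \<open>m + 1\<close> Chebyshev points of \<open>(-1, 1)\<close>, i.e. the roots of the Chebyshev polynomial of
  degree \<open>m + 1\<close>, indexed by \<open>i \<le> m\<close>.\<close>

definition cheb_point :: "nat \<Rightarrow> nat \<Rightarrow> real" where
  "cheb_point m i = cos (real (2 * i + 1) * pi / real (2 * (m + 1)))"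

definition cheb_node :: "nat \<Rightarrow> real \<Rightarrow> real \<Rightarrow> nat \<Rightarrow> real" where
  "cheb_node m l u i = (l + u) / 2 + (u - l) / 2 * cheb_point m i"

definition cheb_lagrange :: "nat \<Rightarrow> real \<Rightarrow> real \<Rightarrow> nat \<Rightarrow> real \<Rightarrow> real" where
  "cheb_lagrange m l u i x =
     (\<Prod>j\<in>{..m} - {i}. (x - cheb_node m l u j) / (cheb_node m l u i - cheb_node m l u j))"

text \<open>The Lebesgue function is continuous on \<open>[-1, 1]\<close>, so this real supremum is a genuine one.\<close>

definition cheb_lebesgue :: "nat \<Rightarrow> real" where
  "cheb_lebesgue m = (SUP x\<in>{-1..1}. \<Sum>i\<le>m. \<bar>cheb_lagrange m (-1) 1 i x\<bar>)"

text \<open>Tensor-product Chebyshev interpolation on the box \<open>cbox l u\<close> of an arbitrary Euclidean space,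
  with degree at most \<open>m\<close> in each variable; a multi-index \<open>\<nu>\<close> assigns a number \<open>\<le> m\<close> to each
  coordinate direction. The type \<open>real^3 \<times> real^3\<close> is a Euclidean space with six basis vectors,
  in which \<open>cbox (l, l') (u, u') = cbox l u \<times> cbox l' u'\<close>.\<close>

definition tensor_cheb_interp ::
  "nat \<Rightarrow> 'a::euclidean_space \<Rightarrow> 'a \<Rightarrow> ('a \<Rightarrow> complex) \<Rightarrow> 'a \<Rightarrow> complex" where
  "tensor_cheb_interp m l u f x =
     (\<Sum>\<nu>\<in>Basis \<rightarrow>\<^sub>E {..m}.
        complex_of_real (\<Prod>k\<in>Basis. cheb_lagrange m (l \<bullet> k) (u \<bullet> k) (\<nu> k) (x \<bullet> k)) *
        f (\<Sum>k\<in>Basis. cheb_node m (l \<bullet> k) (u \<bullet> k) (\<nu> k) *\<^sub>R k))"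

definition G :: "complex \<Rightarrow> real^3 \<Rightarrow> complex" where
  "G \<zeta> z = exp (- \<zeta> * of_real (norm z)) / of_real (4 * pi * norm z)"

definition G_dir :: "complex \<Rightarrow> real^3 \<Rightarrow> real^3 \<Rightarrow> complex" where
  "G_dir \<zeta> c z =
     of_real (exp (- Re \<zeta> * norm z)) *
     exp (- \<i> * of_real (Im \<zeta> * (norm z - z \<bullet> c))) / of_real (4 * pi * norm z)"

lemma G_eq_G_dir: "G \<zeta> z = exp (- \<i> * of_real (Im \<zeta> * (z \<bullet> c))) * G_dir \<zeta> c z"
proof -
  have "- \<zeta> * of_real (norm z) = - \<i> * of_real (Im \<zeta> * (z \<bullet> c)) + (of_real (- Re \<zeta> * norm z) +
      - \<i> * of_real (Im \<zeta> * (norm z - z \<bullet> c)))"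
    by (simp add: complex_eq_iff algebra_simps)
  then show ?thesis
    unfolding G_def G_dir_def exp_of_real[symmetric] by (simp only: exp_add) simp
qed

text \<open>The directional interpolant on \<open>cbox lt ut \<times> cbox ls us\<close>.\<close>

definition G_approx ::
  "complex \<Rightarrow> real^3 \<Rightarrow> nat \<Rightarrow> real^3 \<Rightarrow> real^3 \<Rightarrow> real^3 \<Rightarrow> real^3 \<Rightarrow> real^3 \<Rightarrow> real^3 \<Rightarrow> complex"
where
  "G_approx \<zeta> c m lt ut ls us x y =
     exp (- \<i> * of_real (Im \<zeta> * ((x - y) \<bullet> c))) *
     tensor_cheb_interp m (lt, ls) (ut, us) (\<lambda>(x', y'). G_dir \<zeta> c (x' - y')) (x, y)"

definition beta_hat :: "real \<Rightarrow> real \<Rightarrow> real" where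
  "beta_hat \<eta>2 \<eta>3 =
     Min {1, (sqrt (3/2) - 1) * (2 / \<eta>2), 2 * (1 - \<eta>3) / (\<eta>2\<^sup>2 * (2 * sqrt 6 + 5))}"

definition rho0 :: "real \<Rightarrow> real \<Rightarrow> real" where
  "rho0 \<eta>2 \<eta>3 = 1 + beta_hat \<eta>2 \<eta>3"

definition alpha :: "real \<Rightarrow> real \<Rightarrow> real" where
  "alpha \<eta>2 \<eta>3 =
     (sqrt ((beta_hat \<eta>2 \<eta>3)\<^sup>2 + 1) + beta_hat \<eta>2 \<eta>3) / (beta_hat \<eta>2 \<eta>3 + 1)"

text \<open>The suprema below range over bounded sets, since \<open>cheb_lebesgue m\<close> grows only logarithmically
  in \<open>m\<close> and \<open>alpha \<eta>2 \<eta>3 > 1\<close> in the admissible parameter range.\<close>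

definition C1 :: "real \<Rightarrow> real \<Rightarrow> real \<Rightarrow> real" where
  "C1 \<eta>1 \<eta>2 \<eta>3 =
     exp \<eta>1 * (SUP m::nat. 8 * (cheb_lebesgue m + 1) /
       ((rho0 \<eta>2 \<eta>3 - 1) * alpha \<eta>2 \<eta>3 powr (real m / 2)))"

definition C0 :: "real \<Rightarrow> real \<Rightarrow> real \<Rightarrow> real" where
  "C0 \<eta>1 \<eta>2 \<eta>3 =
     (SUP m::nat. 6 * (cheb_lebesgue m ^ 5 / alpha \<eta>2 \<eta>3 powr (real m / 2)) * C1 \<eta>1 \<eta>2 \<eta>3)"

end

theory Submission
  imports Defs "HOL-Complex_Analysis.Cauchy_Integral_Formula" "HOL-Real_Asymp.Real_Asymp"
begin

text \<open>Restricted to a coordinate line \<open>z + t p\<close> with \<open>t \<in> [-1, 1]\<close>, the modified kernel extends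
  holomorphically to the points at distance at most \<open>\<beta>\<close> from \<open>[-1, 1]\<close>, with \<open>\<parallel>z + t p\<parallel>\<close> replaced by
  \<open>r(t) = sqrt (z\<bullet>z + 2 t z\<bullet>p + t\<^sup>2 p\<bullet>p)\<close>. Around a real point with \<open>R = \<parallel>z\<parallel>\<close>, the root \<open>r(\<tau>)\<close> differs
  from \<open>R + \<tau> z\<bullet>p / R\<close> only by a term quadratic in \<open>\<tau> p\<close>, and the linear term is nearly cancelled
  by \<open>\<tau> p\<bullet>c\<close> as \<open>c\<close> is close to the direction \<open>z / R\<close>. The admissibility conditions thus bound the growth
  caused by the oscillating factor by a constant or by a part of the decay \<open>exp (- Re \<zeta> R)\<close>.
  This neighbourhood of \<open>[-1, 1]\<close> contains the Bernstein ellipse with parameter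
  \<open>\<rho> = \<beta> + sqrt (1 + \<beta>\<^sup>2) = \<alpha> \<rho>\<^sub>0\<close>, so univariate interpolation converges like \<open>\<rho>\<^sup>-\<^sup>m\<close>; the surplus factor
  \<open>\<alpha>\<^sup>-\<^sup>m\<close> absorbs the Lebesgue constants, which enter once per univariate estimate and five more times
  through the tensor product.\<close>

section \<open>Chebyshev interpolation in one variable\<close>

definition cheb_angle :: "nat \<Rightarrow> nat \<Rightarrow> real" where
  "cheb_angle m i = real (2 * i + 1) * pi / real (2 * (m + 1))"

lemma cheb_point_eq_cos: "cheb_point m i = cos (cheb_angle m i)"
  by (simp add: cheb_point_def cheb_angle_def)

lemma cheb_angle_altdef: "cheb_angle m i = (real i + 1 / 2) * pi / real (m + 1)"
proof -
  have "real (2 * i + 1) * pi = 2 * ((real i + 1 / 2) * pi)" "real (2 * (m + 1)) = 2 * real (m + 1)"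
    by (simp_all add: algebra_simps)
  then show ?thesis by (simp only: cheb_angle_def mult_divide_mult_cancel_left_if) simp
qed

lemma cheb_angle_bounds:
  assumes "i \<le> m"
  shows "0 < cheb_angle m i" "cheb_angle m i < pi"
proof -
  show "0 < cheb_angle m i" by (simp add: cheb_angle_def)
  have "real (2 * i + 1) * pi < real (2 * (m + 1)) * pi"
    using assms by (intro mult_strict_right_mono) auto
  then show "cheb_angle m i < pi" by (simp add: cheb_angle_def divide_simps mult.commute)
qed

lemma cheb_point_bounds: "-1 \<le> cheb_point m i" "cheb_point m i \<le> 1"
  by (auto simp: cheb_point_eq_cos)

lemma inj_on_cheb_point: "inj_on (cheb_point m) {..m}"
proof (rule inj_onI)
  fix i j assume ij: "i \<in> {..m}" "j \<in> {..m}" and eq: "cheb_point m i = cheb_point m j"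
  have "cheb_angle m i = cheb_angle m j"
    using cheb_angle_bounds[of i m] cheb_angle_bounds[of j m] ij eq
    by - (rule cos_inj_pi, auto simp: cheb_point_eq_cos)
  then show "i = j" by (simp add: cheb_angle_def field_simps)
qed

lemma cheb_node_ref [simp]: "cheb_node m (-1) 1 i = cheb_point m i"
  by (simp add: cheb_node_def)

text \<open>The factor \<open>(u - l) / 2\<close> cancels in each quotient, so univariate facts need
  proof only on \<open>[-1, 1]\<close>.\<close>

lemma cheb_lagrange_affine:
  assumes "l < u"
  shows "cheb_lagrange m l u i ((l + u) / 2 + (u - l) / 2 * t) = cheb_lagrange m (-1) 1 i t"
proof -
  have "(((l + u) / 2 + (u - l) / 2 * t) - cheb_node m l u j) /
      (cheb_node m l u i - cheb_node m l u j) =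
      (t - cheb_point m j) / (cheb_point m i - cheb_point m j)" for j
  proof -
    have "((l + u) / 2 + (u - l) / 2 * t) - cheb_node m l u j = (u - l) / 2 * (t - cheb_point m j)"
      "cheb_node m l u i - cheb_node m l u j = (u - l) / 2 * (cheb_point m i - cheb_point m j)"
      by (simp_all add: cheb_node_def field_simps)
    then show ?thesis using assms by (simp only: mult_divide_mult_cancel_left_if) simp
  qed
  then show ?thesis by (simp only: cheb_lagrange_def cheb_node_ref)
qed

lemma cheb_lagrange_at_node:
  assumes "i \<le> m" "j \<le> m"
  shows "cheb_lagrange m (-1) 1 i (cheb_point m j) = (if i = j then 1 else 0)"
proof (cases "i = j")
  case True
  have "cheb_point m j \<noteq> cheb_point m k" if "k \<in> {..m} - {j}" for k
    using inj_on_cheb_point[of m] that assms by (auto simp: inj_on_def)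
  then show ?thesis using True by (auto simp: cheb_lagrange_def)
next
  case False
  then show ?thesis using assms by (auto simp: cheb_lagrange_def)
qed

text \<open>Both sides are polynomials in \<open>x\<close> of degree at most \<open>m\<close>, and
  they agree at the \<open>m + 1\<close> distinct Chebyshev points.\<close>

lemma cheb_interp_poly:
  fixes p :: "real poly"
  assumes "degree p \<le> m"
  shows "(\<Sum>i\<le>m. cheb_lagrange m (-1) 1 i x * poly p (cheb_point m i)) = poly p x"
proof -
  define L where "L i = (\<Prod>j\<in>{..m} - {i}.
    smult (1 / (cheb_point m i - cheb_point m j)) [:- cheb_point m j, 1:])" for i
  have poly_L: "poly (L i) y = cheb_lagrange m (-1) 1 i y" for i y
    by (simp add: L_def cheb_lagrange_def poly_prod diff_divide_distrib)
  have deg_L: "degree (L i) \<le> m" if "i \<le> m" for i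
  proof -
    have deg_factor: "degree (smult a [:b, 1:]) \<le> 1" for a b :: real
      by (rule order_trans[OF degree_smult_le]) simp
    have "degree (L i) \<le> (\<Sum>j\<in>{..m} - {i}. 1)"
      unfolding L_def
      by (rule order_trans[OF degree_prod_sum_le])
        (simp, unfold o_def, intro sum_mono deg_factor)
    also have "\<dots> \<le> m" using that by simp
    finally show ?thesis .
  qed
  define q where "q = (\<Sum>i\<le>m. smult (poly p (cheb_point m i)) (L i))"
  have "q = p"
  proof (rule poly_eqI_degree[where A = "cheb_point m ` {..m}"])
    have card: "card (cheb_point m ` {..m}) = m + 1"
      by (simp add: card_image inj_on_cheb_point)
    show "card (cheb_point m ` {..m}) > degree p" using card assms by simp
    have "degree q \<le> m"
      unfolding q_def by (intro degree_sum_le) (auto intro: order_trans[OF degree_smult_le] deg_L)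
    then show "card (cheb_point m ` {..m}) > degree q" using card by simp
    fix y assume "y \<in> cheb_point m ` {..m}"
    then obtain j where j: "j \<le> m" "y = cheb_point m j" by auto
    have "poly q y = (\<Sum>i\<le>m. if i = j then poly p (cheb_point m i) else 0)"
      unfolding q_def poly_sum
      by (rule sum.cong) (use j in \<open>auto simp: poly_L cheb_lagrange_at_node\<close>)
    then show "poly q y = poly p y" using j by simp
  qed
  then have "poly q x = poly p x" by simp
  then show ?thesis by (simp add: q_def poly_sum poly_L mult.commute)
qed

text \<open>These are the Chebyshev polynomials of the first kind, built by the recurrence
  \<open>T (k + 2) = 2 x T (k + 1) - T k\<close>.\<close>

lemma cos_multiple_poly:
  "\<exists>p::real poly. degree p \<le> n \<and> (\<forall>t. poly p (cos t) = cos (real n * t))"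
proof (induction n rule: less_induct)
  case (less n)
  consider "n = 0" | "n = 1" | k where "n = Suc (Suc k)"
    by (metis One_nat_def old.nat.exhaust)
  then show ?case
  proof cases
    case 1
    then show ?thesis by (intro exI[of _ 1]) auto
  next
    case 2
    then show ?thesis by (intro exI[of _ "[:0, 1:]"]) auto
  next
    case 3
    obtain p q :: "real poly" where
      p: "degree p \<le> k" "\<And>t. poly p (cos t) = cos (real k * t)" and
      q: "degree q \<le> Suc k" "\<And>t. poly q (cos t) = cos (real (Suc k) * t)"
      using less.IH[of k] less.IH[of "Suc k"] 3 by auto
    have "degree ([:0, 2:] * q - p) \<le> n"
    proof (rule degree_diff_le)
      show "degree ([:0, 2:] * q) \<le> n"
        using degree_mult_le[of "[:0, 2:]" q] q(1) 3 by simp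
    qed (use p 3 in simp)
    moreover have "poly ([:0, 2:] * q - p) (cos t) = cos (real n * t)" for t
    proof -
      define a where "a = real (Suc k) * t"
      have "real n * t = a + t" "real k * t = a - t"
        using 3 by (simp_all add: a_def algebra_simps)
      then have "cos (real n * t) = 2 * cos t * cos a - cos (real k * t)"
        by (simp only: cos_add cos_diff) (simp add: algebra_simps)
      then show ?thesis by (simp add: p q a_def del: of_nat_Suc)
    qed
    ultimately show ?thesis by blast
  qed
qed

lemma cheb_interp_cos:
  assumes "k \<le> m"
  shows "(\<Sum>i\<le>m. cheb_lagrange m (-1) 1 i (cos t) * cos (real k * cheb_angle m i)) =
    cos (real k * t)"
proof -
  obtain p :: "real poly" where p: "degree p \<le> k" "\<And>t. poly p (cos t) = cos (real k * t)"
    using cos_multiple_poly by blast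
  show ?thesis
    using cheb_interp_poly[of p m "cos t"] p assms by (simp add: cheb_point_eq_cos)
qed

section \<open>The Lebesgue constant\<close>

lemma sin_half_times_Dirichlet:
  "sin (x / 2) * (1 + 2 * (\<Sum>k=1..m. cos (real k * x))) = sin ((real m + 1 / 2) * x)"
proof (induction m)
  case (Suc m)
  \<comment> \<open>The sum telescopes: each term is a difference of sines at consecutive
    half-integer multiples of \<open>x\<close>.\<close>
  have "sin ((real (Suc m) + 1 / 2) * x) - sin ((real m + 1 / 2) * x) =
      2 * sin (x / 2) * cos (real (Suc m) * x)"
  proof -
    have "((real (Suc m) + 1 / 2) * x - (real m + 1 / 2) * x) / 2 = x / 2"
      "((real (Suc m) + 1 / 2) * x + (real m + 1 / 2) * x) / 2 = real (Suc m) * x"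
      by (simp_all add: field_simps)
    then show ?thesis by (simp only: sin_diff_sin)
  qed
  then show ?case using Suc by (simp add: algebra_simps)
qed simp

text \<open>For \<open>x = n pi / (m + 1)\<close> the angle \<open>(m + 1 / 2) x\<close> equals
  \<open>n pi - x / 2\<close>, so the closed form of the Dirichlet kernel collapses to
  \<open>- cos (n pi)\<close>.\<close>

lemma cheb_Dirichlet:
  assumes "sin (real_of_int n * pi / real (2 * (m + 1))) \<noteq> 0"
  shows "1 + 2 * (\<Sum>k=1..m. cos (real k * (real_of_int n * pi / real (m + 1)))) = (if even n then -1 else 1)"
proof -
  define x where "x = real_of_int n * pi / real (m + 1)"
  have x2: "x / 2 = real_of_int n * pi / real (2 * (m + 1))" by (simp add: x_def field_simps)
  have "(real m + 1 / 2) * x = real_of_int n * pi - x / 2" by (simp add: x_def field_simps)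
  then have "sin (x / 2) * (1 + 2 * (\<Sum>k=1..m. cos (real k * x))) = 
     sin (x / 2) * (if even n then -1 else 1)"
    unfolding sin_half_times_Dirichlet
    by (simp add: sin_diff mult.commute[of "real_of_int n"])
  moreover have "sin (x / 2) \<noteq> 0" unfolding x2 by (rule assms)
  ultimately show ?thesis unfolding x_def[symmetric] mult_cancel_left by blast
qed

text \<open>The product-to-sum formula gives the mean of two Dirichlet kernels, at the sum and at
  the difference of the angles. Their indices \<open>a\<close> and \<open>b\<close> have opposite
  parity, so the values -1 and 1 cancel for distinct nodes; for equal nodes they are 1 and
  \<open>2 m + 1\<close>.\<close>

lemma cheb_discrete_orthogonality:
  assumes "i \<le> m" "j \<le> m"
  shows "1 + 2 * (\<Sum>k=1..m. cos (real k * cheb_angle m i) * cos (real k * cheb_angle m j)) =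
    (if i = j then real (m + 1) else 0)"
proof -
  define D where "D n = 1 + 2 * (\<Sum>k=1..m. cos (real k * (real_of_int n * pi / real (m + 1))))" for n
  \<comment> \<open>The angles are odd multiples of half of \<open>pi / (m + 1)\<close>; the two
    halves add up to the \<open>+ 1\<close> in \<open>a\<close> and cancel in
    \<open>b\<close>.\<close>
  define a where "a = int i + int j + 1"
  define b where "b = int i - int j"
  have ang: "cheb_angle m i + cheb_angle m j = real_of_int a * pi / real (m + 1)"
    "cheb_angle m i - cheb_angle m j = real_of_int b * pi / real (m + 1)"
    unfolding cheb_angle_altdef a_def b_def add_divide_distrib[symmetric] diff_divide_distrib[symmetric]
    by (simp_all add: algebra_simps)
  have prod: "2 * (cos (real k * cheb_angle m i) * cos (real k * cheb_angle m j)) =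
      cos (real k * (real_of_int a * pi / real (m + 1))) + cos (real k * (real_of_int b * pi / real (m + 1)))" for k
    unfolding ang[symmetric] distrib_left right_diff_distrib cos_add cos_diff by simp
  have "2 * (1 + 2 * (\<Sum>k=1..m. cos (real k * cheb_angle m i) * cos (real k * cheb_angle m j))) = D a + D b"
    unfolding D_def sum_distrib_left[of 2 "\<lambda>k. cos (real k * cheb_angle m i) * cos (real k * cheb_angle m j)"] prod sum.distrib by simp
  moreover have "D a = (if even a then -1 else 1)"
    unfolding D_def
  proof (rule cheb_Dirichlet)
    have "real_of_int a * pi < real (2 * (m + 1)) * pi"
      using assms by (intro mult_strict_right_mono) (auto simp: a_def)
    then have "real_of_int a * pi / real (2 * (m + 1)) < pi"
      by (simp add: divide_simps mult.commute)
    moreover have "0 < real_of_int a * pi / real (2 * (m + 1))" by (simp add: a_def)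
    ultimately show "sin (real_of_int a * pi / real (2 * (m + 1))) \<noteq> 0"
      using sin_gt_zero by fastforce
  qed
  moreover have "D b = (if even b then -1 else 1)" if "i \<noteq> j"
    unfolding D_def
  proof (rule cheb_Dirichlet)
    define y where "y = real_of_int b * pi / real (2 * (m + 1))"
    have "\<bar>real_of_int b\<bar> * pi < real (2 * (m + 1)) * pi"
      using assms by (intro mult_strict_right_mono) (auto simp: b_def)
    then have "\<bar>y\<bar> < pi"
      by (simp add: y_def abs_mult divide_simps mult.commute)
    moreover have "y \<noteq> 0" using that by (simp add: y_def b_def)
    ultimately have "sin y \<noteq> 0" using sin_eq_0_pi[of y] by (auto simp: abs_less_iff)
    then show "sin (real_of_int b * pi / real (2 * (m + 1))) \<noteq> 0" by (simp add: y_def)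
  qed
  moreover have "D b = 1 + 2 * real m" if "i = j" using that by (simp add: D_def b_def)
  moreover have "even a \<longleftrightarrow> odd b" by (simp add: a_def b_def)
  moreover have "odd a" if "i = j" using that by (simp add: a_def)
  ultimately show ?thesis by (cases "i = j") (auto split: if_splits)
qed

text \<open>Discrete orthogonality writes the Kronecker delta at node \<open>j\<close> as a cosine
  sum; interpolation over \<open>j\<close> reproduces each \<open>cos (k t)\<close> because
  \<open>k \<le> m\<close>.\<close>

lemma cheb_lagrange_cos:
  assumes "i \<le> m"
  shows "cheb_lagrange m (-1) 1 i (cos t) =
    (1 + 2 * (\<Sum>k=1..m. cos (real k * cheb_angle m i) * cos (real k * t))) / real (m + 1)"
proof -
  have one: "(\<Sum>j\<le>m. cheb_lagrange m (-1) 1 j (cos t)) = 1"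
    using cheb_interp_cos[of 0 m t] by simp
  have "real (m + 1) * cheb_lagrange m (-1) 1 i (cos t) =
     (\<Sum>j\<le>m. if i = j then real (m + 1) * cheb_lagrange m (-1) 1 j (cos t) else 0)"
    using assms by simp
  also have "\<dots> = (\<Sum>j\<le>m. cheb_lagrange m (-1) 1 j (cos t) *
       (1 + 2 * (\<Sum>k=1..m. cos (real k * cheb_angle m i) * cos (real k * cheb_angle m j))))"
    by (intro sum.cong refl, subst cheb_discrete_orthogonality[OF assms]) auto
  also have "\<dots> = 1 + 2 * (\<Sum>j\<le>m. \<Sum>k=1..m. cos (real k * cheb_angle m i) *
       (cheb_lagrange m (-1) 1 j (cos t) * cos (real k * cheb_angle m j)))"
    by (simp add: distrib_left sum.distrib one sum_distrib_left mult_ac)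
  also have "(\<Sum>j\<le>m. \<Sum>k=1..m. cos (real k * cheb_angle m i) *
       (cheb_lagrange m (-1) 1 j (cos t) * cos (real k * cheb_angle m j))) =
     (\<Sum>k=1..m. cos (real k * cheb_angle m i) * cos (real k * t))"
    by (subst sum.swap, intro sum.cong refl)
       (simp add: cheb_interp_cos flip: sum_distrib_left)
  finally show ?thesis by (simp add: field_simps)
qed

section \<open>Bounds for the Lebesgue constant\<close>

lemma abs_cheb_lagrange_le:
  assumes "i \<le> m" "-1 \<le> x" "x \<le> 1"
  shows "\<bar>cheb_lagrange m (-1) 1 i x\<bar> \<le> 2"
proof -
  define t where "t = arccos x"
  have x: "x = cos t" using assms by (simp add: t_def)
  have "\<bar>\<Sum>k=1..m. cos (real k * cheb_angle m i) * cos (real k * t)\<bar> \<le> (\<Sum>k=1..m. 1)"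
    by (rule order_trans[OF sum_abs]) (intro sum_mono, simp add: abs_mult mult_le_one)
  then have "\<bar>1 + 2 * (\<Sum>k=1..m. cos (real k * cheb_angle m i) * cos (real k * t))\<bar> \<le> 2 * real (m + 1)"
    by simp
  then show ?thesis
    unfolding x cheb_lagrange_cos[OF assms(1)] by (simp add: field_simps)
qed

text \<open>A linear bound is enough: it makes the defining supremum a genuine upper bound, and in
  the constants it only competes with the exponential growth of the powers of
  \<open>alpha\<close>.\<close>

lemma
  shows cheb_lebesgue_le: "cheb_lebesgue m \<le> 2 * real (m + 1)"
    and sum_abs_cheb_lagrange_le:
      "-1 \<le> x \<Longrightarrow> x \<le> 1 \<Longrightarrow> (\<Sum>i\<le>m. \<bar>cheb_lagrange m (-1) 1 i x\<bar>) \<le> cheb_lebesgue m"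
proof -
  have bound: "(\<Sum>i\<le>m. \<bar>cheb_lagrange m (-1) 1 i x\<bar>) \<le> 2 * real (m + 1)" if "x \<in> {-1..1}" for x
    using sum_mono[of "{..m}" "\<lambda>i. \<bar>cheb_lagrange m (-1) 1 i x\<bar>" "\<lambda>_. 2"] abs_cheb_lagrange_le that
    by simp
  then show "cheb_lebesgue m \<le> 2 * real (m + 1)"
    unfolding cheb_lebesgue_def by (intro cSUP_least) auto
  show "(\<Sum>i\<le>m. \<bar>cheb_lagrange m (-1) 1 i x\<bar>) \<le> cheb_lebesgue m" if "-1 \<le> x" "x \<le> 1"
    unfolding cheb_lebesgue_def using that bound
    by (intro cSUP_upper2[where x = x] bdd_aboveI2[where M = "2 * real (m + 1)"]) auto
qed

text \<open>The Lagrange basis sums to 1, so the Lebesgue function is at least 1, read off here at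
  \<open>cos 0\<close>.\<close>

lemma cheb_lebesgue_ge_1: "1 \<le> cheb_lebesgue m"
proof -
  have "1 = \<bar>\<Sum>i\<le>m. cheb_lagrange m (-1) 1 i (cos 0)\<bar>"
    using cheb_interp_cos[of 0 m 0] by simp
  also have "\<dots> \<le> (\<Sum>i\<le>m. \<bar>cheb_lagrange m (-1) 1 i 1\<bar>)" by simp
  also have "\<dots> \<le> cheb_lebesgue m" by (rule sum_abs_cheb_lagrange_le) auto
  finally show ?thesis .
qed

text \<open>Serves to show that the real suprema in \<open>C1\<close> and \<open>C0\<close> range
  over bounded sets: a polynomial over an exponential tends to 0, and convergent sequences are
  bounded.\<close>

lemma bdd_above_polynomial_over_powr:
  fixes f :: "nat \<Rightarrow> real"
  assumes "a > 1" "\<And>m. \<bar>f m\<bar> \<le> C * real (m + 1) ^ n"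
  shows "bdd_above (range (\<lambda>m. f m / a powr (real m / 2)))"
proof -
  have "(\<lambda>m. C * real (m + 1) ^ n / a powr (real m / 2)) \<longlonglongrightarrow> 0"
    using assms(1) by real_asymp
  then have "Bseq (\<lambda>m. C * real (m + 1) ^ n / a powr (real m / 2))"
    by (intro convergent_imp_Bseq convergentI)
  then obtain K where K: "\<And>m. norm (C * real (m + 1) ^ n / a powr (real m / 2)) \<le> K"
    by (auto simp: Bseq_def)
  have "f m / a powr (real m / 2) \<le> K" for m
  proof -
    have "f m / a powr (real m / 2) \<le> C * real (m + 1) ^ n / a powr (real m / 2)"
      using assms(2)[of m] by (intro divide_right_mono) auto
    also have "\<dots> \<le> K" using K[of m] by (simp only: real_norm_def abs_le_iff)
    finally show ?thesis .
  qed
  then show ?thesis by (intro bdd_aboveI2)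
qed

section \<open>Interpolation of holomorphic functions\<close>

text \<open>For \<open>w = 1 / u\<close> and \<open>y = (u + 1 / u) / 2\<close>, the Cauchy kernel \<open>dy / (y - cos t)\<close> equals
  \<open>cheb_kernel t w du / u\<close>. Truncating the two geometric series leaves a polynomial of degree \<open>m\<close>
  in \<open>cos t\<close>, which interpolation reproduces.\<close>

definition cheb_kernel :: "real \<Rightarrow> complex \<Rightarrow> complex" where
  "cheb_kernel t w = 1 / (1 - w * cis t) + 1 / (1 - w * cis (- t)) - 1"

definition cheb_kernel_trunc :: "nat \<Rightarrow> real \<Rightarrow> complex \<Rightarrow> complex" where
  "cheb_kernel_trunc m t w = (\<Sum>k\<le>m. of_real (cos (real k * t)) * (2 * w ^ k)) - 1"

lemma cheb_interp_kernel_trunc: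
  "(\<Sum>i\<le>m. of_real (cheb_lagrange m (-1) 1 i (cos t)) * cheb_kernel_trunc m (cheb_angle m i) w) =
    cheb_kernel_trunc m t w"
proof -
  define L where "L i = complex_of_real (cheb_lagrange m (-1) 1 i (cos t))" for i
  have cos: "(\<Sum>i\<le>m. L i * of_real (cos (real k * cheb_angle m i))) = of_real (cos (real k * t))"
    if "k \<le> m" for k
    using arg_cong[OF cheb_interp_cos[OF that, of t], of complex_of_real] by (simp add: L_def)
  have one: "(\<Sum>i\<le>m. L i) = 1" using cos[of 0] by simp
  have "(\<Sum>i\<le>m. L i * cheb_kernel_trunc m (cheb_angle m i) w) =
     (\<Sum>i\<le>m. \<Sum>k\<le>m. (L i * of_real (cos (real k * cheb_angle m i))) * (2 * w ^ k)) - 1"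
    by (simp add: cheb_kernel_trunc_def right_diff_distrib sum_subtractf one sum_distrib_left mult_ac)
  also have "(\<Sum>i\<le>m. \<Sum>k\<le>m. (L i * of_real (cos (real k * cheb_angle m i))) * (2 * w ^ k)) =
     (\<Sum>k\<le>m. of_real (cos (real k * t)) * (2 * w ^ k))"
    by (subst sum.swap, intro sum.cong refl) (simp only: atMost_iff cos flip: sum_distrib_right)
  finally show ?thesis by (simp add: L_def cheb_kernel_trunc_def)
qed

lemma norm_geometric_remainder:
  fixes a :: complex
  assumes "norm a < 1"
  shows "norm (1 / (1 - a) - (\<Sum>k\<le>m. a ^ k)) \<le> norm a ^ (m + 1) / (1 - norm a)"
proof -
  have a: "1 - a \<noteq> 0" using assms by auto
  have "(\<Sum>k\<le>m. a ^ k) = (1 - a ^ (m + 1)) / (1 - a)"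
    using a by (simp add: sum_gp0)
  then have "1 / (1 - a) - (\<Sum>k\<le>m. a ^ k) = a ^ (m + 1) / (1 - a)"
    using a by (simp add: divide_simps)
  moreover have "1 - norm a \<le> norm (1 - a)"
    using norm_triangle_ineq2[of 1 a] by simp
  ultimately show ?thesis
    using assms by (simp add: norm_divide norm_power norm_mult del: power_Suc) (intro divide_left_mono mult_pos_pos, auto)
qed

text \<open>Since \<open>2 cos (k t)\<close> is \<open>cis t ^ k + cis (- t) ^ k\<close>, the
  remainder consists of the tails of two geometric series with ratios of modulus
  \<open>norm w\<close>.\<close>

lemma norm_cheb_kernel_remainder:
  assumes "norm w < 1"
  shows "norm (cheb_kernel t w - cheb_kernel_trunc m t w) \<le> 2 * norm w ^ (m + 1) / (1 - norm w)"
proof -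
  have "of_real (cos (real k * t)) * (2 * w ^ k) = (w * cis t) ^ k + (w * cis (- t)) ^ k" for k
  proof -
    have "cis t ^ k + cis (- t) ^ k = 2 * of_real (cos (real k * t))"
      unfolding Complex.DeMoivre by (simp add: complex_eq_iff)
    then show ?thesis by (simp add: power_mult_distrib flip: distrib_left)
  qed
  then have "cheb_kernel t w - cheb_kernel_trunc m t w =
     (1 / (1 - w * cis t) - (\<Sum>k\<le>m. (w * cis t) ^ k)) +
     (1 / (1 - w * cis (- t)) - (\<Sum>k\<le>m. (w * cis (- t)) ^ k))"
    by (simp add: cheb_kernel_def cheb_kernel_trunc_def sum.distrib)
  also have "norm \<dots> \<le> norm w ^ (m + 1) / (1 - norm w) + norm w ^ (m + 1) / (1 - norm w)"
    using norm_geometric_remainder[of "w * cis t" m] norm_geometric_remainder[of "w * cis (- t)" m]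
    by (intro norm_triangle_mono) (use assms in \<open>auto simp: norm_mult\<close>)
  finally show ?thesis by simp
qed

section \<open>The Joukowski map and the Bernstein ellipse\<close>

definition circ :: "real \<Rightarrow> real \<Rightarrow> complex" where
  "circ \<rho> s = of_real \<rho> * exp (2 * of_real pi * \<i> * of_real s)"

lemma circ_facts:
  assumes "\<rho> > 0"
  shows "circ \<rho> s \<noteq> 0" "norm (circ \<rho> s) = \<rho>" "norm (inverse (circ \<rho> s)) = inverse \<rho>"
  using assms by (auto simp: circ_def norm_mult norm_inverse)

lemma circ_eq_cis: "circ \<rho> s = of_real \<rho> * cis (2 * pi * s)"
  by (simp add: circ_def cis_conv_exp mult_ac)

definition joukowski :: "complex \<Rightarrow> complex" where
  "joukowski u = (u + inverse u) / 2"

text \<open>As \<open>cos t\<close> is the Joukowski image of \<open>cis t\<close> and of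
  \<open>cis (- t)\<close>, these are the two zeros in \<open>u\<close>.\<close>

lemma joukowski_minus_cos:
  assumes "u \<noteq> 0"
  shows "joukowski u - of_real (cos t) =
    u / 2 * ((1 - inverse u * cis t) * (1 - inverse u * cis (- t)))"
proof -
  have "cis t + cis (- t) = 2 * of_real (cos t)" by (simp add: complex_eq_iff)
  moreover have "cis t * cis (- t) = 1" by (simp add: cis_mult)
  moreover have "(1 - inverse u * cis t) * (1 - inverse u * cis (- t)) =
     1 - inverse u * (cis t + cis (- t)) + inverse u ^ 2 * (cis t * cis (- t))"
    by (simp add: algebra_simps power2_eq_square)
  ultimately show ?thesis
    using assms by (simp add: joukowski_def field_simps power2_eq_square)
qed

lemma one_minus_cis_nonzero:
  assumes "norm w < 1"
  shows "1 - w * cis t \<noteq> 0"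
proof
  assume "1 - w * cis t = 0"
  then have "norm (w * cis t) = 1" by (metis eq_iff_diff_eq_0 norm_one)
  then show False using assms by (simp add: norm_mult)
qed

text \<open>This is the change of variables behind \<open>cheb_kernel\<close>: the numerator
  \<open>(u - inverse u) / 2\<close> is \<open>u\<close> times the derivative of
  \<open>joukowski\<close>, and the partial fractions come from
  \<open>p + q - p * q = 1 - w ^ 2\<close>.\<close>

lemma joukowski_kernel:
  assumes "norm u > 1"
  shows "((u - inverse u) / 2) / (joukowski u - of_real (cos t)) = cheb_kernel t (inverse u)"
    and "joukowski u \<noteq> of_real (cos t)"
proof -
  have u: "u \<noteq> 0" using assms by auto
  define w where "w = inverse u"
  have w: "norm w < 1" using assms u by (simp add: w_def norm_inverse inverse_less_1_iff)
  define p q where "p = 1 - w * cis t" and "q = 1 - w * cis (- t)"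
  have pq: "p \<noteq> 0" "q \<noteq> 0" unfolding p_def q_def using w by (auto simp only: one_minus_cis_nonzero not_False_eq_True)
  have J: "joukowski u - of_real (cos t) = u / 2 * (p * q)"
    using joukowski_minus_cos[OF u] by (simp only: p_def q_def w_def)
  then show "joukowski u \<noteq> of_real (cos t)" using pq u by auto
  have "w * cis t * (w * cis (- t)) = w ^ 2 * (cis t * cis (- t))" by (simp add: power2_eq_square)
  also have "\<dots> = w ^ 2" by (simp add: cis_mult)
  finally have "p + q - p * q = 1 - w ^ 2" by (simp add: p_def q_def algebra_simps)
  then have "cheb_kernel t w = (1 - w ^ 2) / (p * q)"
    using pq by (simp add: cheb_kernel_def divide_simps flip: p_def q_def) (simp add: algebra_simps)
  moreover have "(u - inverse u) / 2 = u / 2 * (1 - w ^ 2)"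
    using u by (simp add: w_def field_simps power2_eq_square)
  ultimately show "((u - inverse u) / 2) / (joukowski u - of_real (cos t)) = cheb_kernel t (inverse u)"
    unfolding J using u by (simp add: w_def)
qed

text \<open>For \<open>\<rho> > 1\<close> this is the ellipse with foci -1 and 1 and semi-axes
  \<open>(\<rho> + 1 / \<rho>) / 2\<close> and \<open>(\<rho> - 1 / \<rho>) / 2\<close>, traversed
  once for \<open>s\<close> in \<open>[0, 1]\<close>.\<close>

definition bernstein_ellipse :: "real \<Rightarrow> real \<Rightarrow> complex" where
  "bernstein_ellipse \<rho> s = joukowski (circ \<rho> s)"

lemma bernstein_ellipse_derivative:
  assumes "\<rho> > 0"
  shows "(bernstein_ellipse \<rho> has_vector_derivative
    2 * of_real pi * \<i> * ((circ \<rho> s - inverse (circ \<rho> s)) / 2)) (at s within A)"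
proof -
  have circ: "(circ \<rho> has_vector_derivative 2 * of_real pi * \<i> * circ \<rho> s) (at s within A)"
  proof -
    have "((\<lambda>z. of_real \<rho> * exp (2 * of_real pi * \<i> * z)) has_field_derivative
        2 * of_real pi * \<i> * circ \<rho> s) (at (of_real s))"
      by (auto intro!: derivative_eq_intros simp: circ_def)
    then show ?thesis
      unfolding circ_def[abs_def]
      using has_vector_derivative_real_field has_vector_derivative_at_within by blast
  qed
  have "(joukowski has_field_derivative (1 - inverse (u ^ 2)) / 2) (at u)" if "u \<noteq> 0" for u
    unfolding joukowski_def[abs_def] using that
    by (auto intro!: derivative_eq_intros simp: power2_eq_square)
  from field_vector_diff_chain_within[OF circ has_field_derivative_at_within[OF this[OF circ_facts(1)[OF assms]]]]
  have "(joukowski \<circ> circ \<rho> has_vector_derivative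
      2 * of_real pi * \<i> * circ \<rho> s * ((1 - inverse ((circ \<rho> s)\<^sup>2)) / 2)) (at s within A)" .
  moreover have "2 * of_real pi * \<i> * circ \<rho> s * ((1 - inverse ((circ \<rho> s)\<^sup>2)) / 2) =
      2 * of_real pi * \<i> * ((circ \<rho> s - inverse (circ \<rho> s)) / 2)"
    using circ_facts(1)[OF assms, of s] by (simp add: field_simps power2_eq_square)
  moreover have "joukowski \<circ> circ \<rho> = bernstein_ellipse \<rho>"
    by (auto simp: bernstein_ellipse_def)
  ultimately show ?thesis by simp
qed

lemma valid_path_bernstein_ellipse:
  assumes "\<rho> > 0"
  shows "valid_path (bernstein_ellipse \<rho>)"
  unfolding valid_path_def
proof (rule C1_differentiable_imp_piecewise)
  have "continuous_on {0..1} (\<lambda>s. 2 * of_real pi * \<i> * ((circ \<rho> s - inverse (circ \<rho> s)) / 2))"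
    using circ_facts(1)[OF assms] unfolding circ_def by (intro continuous_intros) auto
  then show "bernstein_ellipse \<rho> C1_differentiable_on {0..1}"
    unfolding C1_differentiable_on_def
    by (intro exI conjI ballI) (rule bernstein_ellipse_derivative[OF assms])
qed

lemma closed_bernstein_ellipse:
  "pathfinish (bernstein_ellipse \<rho>) = pathstart (bernstein_ellipse \<rho>)"
  by (simp add: pathfinish_def pathstart_def bernstein_ellipse_def circ_eq_cis)

section \<open>The neighbourhood of \<open>[-1, 1]\<close> that contains the ellipse\<close>

definition stadium :: "real \<Rightarrow> complex set" where
  "stadium \<beta> = {of_real x + \<tau> |x \<tau>. \<bar>x\<bar> \<le> 1 \<and> norm \<tau> \<le> \<beta>}"

text \<open>The set is the Minkowski sum of a segment and a disc. Its convexity gives access to the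
  Cauchy formula for convex sets.\<close>

lemma convex_stadium: "convex (stadium \<beta>)"
proof -
  have "convex (\<Union>z\<in>complex_of_real ` {-1..1}. \<Union>y\<in>cball 0 \<beta>. {z + y})"
    by (intro convex_sums convex_linear_image convex_cball) (auto simp: linear_of_real)
  also have "(\<Union>z\<in>complex_of_real ` {-1..1}. \<Union>y\<in>cball 0 \<beta>. {z + y}) = stadium \<beta>" (is "?A = _")
  proof (intro set_eqI iffI)
    fix z assume "z \<in> ?A"
    then obtain x y where "x \<in> {-1..1}" "norm y \<le> \<beta>" "z = of_real x + y" by auto
    then show "z \<in> stadium \<beta>"
      unfolding stadium_def by (intro CollectI exI[of _ x] exI[of _ y]) auto
  next
    fix z assume "z \<in> stadium \<beta>"
    then obtain x y where xy: "\<bar>x\<bar> \<le> 1" "norm y \<le> \<beta>" "z = of_real x + y" by (auto simp: stadium_def)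
    then have "x \<in> {-1..1}" unfolding atLeastAtMost_iff by linarith
    with xy have "complex_of_real x \<in> complex_of_real ` {-1..1}" "y \<in> cball 0 \<beta>" "z \<in> {of_real x + y}"
      by auto
    then show "z \<in> ?A" by blast
  qed
  finally show ?thesis .
qed

lemma interior_stadium:
  assumes "\<beta> > 0" "\<bar>x\<bar> \<le> 1"
  shows "of_real x \<in> interior (stadium \<beta>)"
proof -
  have "ball (of_real x) \<beta> \<subseteq> stadium \<beta>"
  proof
    fix z assume "z \<in> ball (complex_of_real x) \<beta>"
    then have "norm (z - of_real x) \<le> \<beta>" by (simp add: dist_norm norm_minus_commute)
    then show "z \<in> stadium \<beta>" using assms(2)
      unfolding stadium_def by (intro CollectI exI[of _ x] exI[of _ "z - of_real x"]) auto
  qed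
  then show ?thesis using assms(1) by (meson centre_in_ball interior_maximal open_ball subsetD)
qed

text \<open>With \<open>a = sqrt (1 + \<beta>\<^sup>2)\<close> the semi-axes are \<open>a\<close>
  and \<open>\<beta>\<close>. The ellipse point \<open>(a cos t, \<beta> sin t)\<close> is compared
  with the real point \<open>cos t\<close>; the offset \<open>((a - 1) cos t, \<beta> sin t)\<close>
  has norm at most \<open>\<beta>\<close> because \<open>a - 1 \<le> \<beta>\<close>.\<close>

lemma bernstein_ellipse_in_stadium:
  assumes "\<beta> > 0" "\<rho> = \<beta> + sqrt (1 + \<beta>\<^sup>2)"
  shows "bernstein_ellipse \<rho> s \<in> stadium \<beta>"
proof -
  define t where "t = 2 * pi * s"
  define a where "a = sqrt (1 + \<beta>\<^sup>2)"
  have a2: "a\<^sup>2 = 1 + \<beta>\<^sup>2" by (simp add: a_def)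
  have a1: "1 \<le> a" by (simp add: a_def)
  have "a \<le> 1 + \<beta>" unfolding a_def using assms(1)
    by (intro real_le_lsqrt) (auto simp: power2_eq_square algebra_simps)
  have "\<rho> * (a - \<beta>) = 1" using a2 unfolding assms(2) a_def[symmetric] by (simp add: power2_eq_square algebra_simps)
  then have inv: "inverse \<rho> = a - \<beta>" by (metis inverse_unique)
  have "inverse (cis t) = cis (- t)" by (simp add: cis_inverse)
  then have "bernstein_ellipse \<rho> s = (of_real \<rho> * cis t + of_real (inverse \<rho>) * cis (- t)) / 2"
    by (simp add: bernstein_ellipse_def joukowski_def circ_eq_cis t_def)
  also have "\<dots> = of_real (cos t) + Complex ((a - 1) * cos t) (\<beta> * sin t)"
    unfolding inv unfolding assms(2) a_def[symmetric] by (simp add: complex_eq_iff algebra_simps)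
  finally have eq: "bernstein_ellipse \<rho> s = of_real (cos t) + Complex ((a - 1) * cos t) (\<beta> * sin t)" .
  have "((a - 1) * cos t)\<^sup>2 + (\<beta> * sin t)\<^sup>2 \<le> \<beta>\<^sup>2 * (cos t)\<^sup>2 + \<beta>\<^sup>2 * (sin t)\<^sup>2"
    unfolding power_mult_distrib using a1 \<open>a \<le> 1 + \<beta>\<close>
    by (intro add_mono mult_right_mono power_mono) auto
  also have "\<dots> = \<beta>\<^sup>2 * ((cos t)\<^sup>2 + (sin t)\<^sup>2)" by (simp only: distrib_left)
  also have "\<dots> = \<beta>\<^sup>2" by simp
  finally have "norm (Complex ((a - 1) * cos t) (\<beta> * sin t)) \<le> \<beta>"
    using assms(1) by (simp add: complex_norm real_le_lsqrt)
  then show ?thesis unfolding eq stadium_def by (intro CollectI exI conjI refl) auto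
qed

section \<open>Cauchy's formula on the ellipse\<close>

lemma kernel_integral_power:
  assumes "\<rho> > 0" "k > 0"
  shows "((\<lambda>s. inverse (circ \<rho> s) ^ k) has_integral 0) {0..1}"
proof -
  define c where "c = - 2 * of_real pi * \<i> * of_nat k"
  have c: "c \<noteq> 0" using assms by (simp add: c_def)
  define F where "F s = inverse (circ \<rho> s) ^ k / c" for s
  have circ: "inverse (circ \<rho> s) ^ k = of_real (inverse \<rho> ^ k) * exp (c * of_real s)" for s
    by (simp add: circ_def c_def exp_minus power_mult_distrib exp_of_nat_mult[symmetric] mult_ac
        flip: power_inverse)
       (simp add: power_inverse exp_minus[symmetric] exp_of_nat_mult[symmetric] mult_ac)
  have "((\<lambda>s. inverse (circ \<rho> s) ^ k) has_integral (F 1 - F 0)) {0..1}"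
  proof (rule fundamental_theorem_of_calculus)
    fix s :: real
    have "((\<lambda>z. of_real (inverse \<rho> ^ k) * exp (c * z) / c) has_field_derivative
       inverse (circ \<rho> s) ^ k) (at (of_real s))"
      unfolding circ using c by (auto intro!: derivative_eq_intros)
    then show "(F has_vector_derivative inverse (circ \<rho> s) ^ k) (at s within {0..1})"
      unfolding F_def[abs_def] circ
      using has_vector_derivative_real_field has_vector_derivative_at_within by blast
  qed simp
  moreover have "circ \<rho> 1 = circ \<rho> 0" by (simp add: circ_eq_cis)
  ultimately show ?thesis by (simp add: F_def)
qed

text \<open>Powers with \<open>k > 0\<close> have mean zero over the circle, so only the constant
  \<open>2 - 1\<close> remains.\<close>

lemma kernel_trunc_integral:
  assumes "\<rho> > 0"
  shows "((\<lambda>s. cheb_kernel_trunc m t (inverse (circ \<rho> s))) has_integral 1) {0..1}"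
proof -
  have "((\<lambda>s. of_real (cos (real k * t)) * (2 * inverse (circ \<rho> s) ^ k)) has_integral
      (if k = 0 then 2 else 0)) {0..1}" for k
  proof (cases "k = 0")
    case True
    then show ?thesis using has_integral_const_real[of "2::complex" 0 1] by simp
  next
    case False
    then show ?thesis
      using has_integral_mult_right[OF kernel_integral_power[OF assms, of k], of "of_real (cos (real k * t)) * 2"]
      by (simp add: mult.assoc)
  qed
  then have "((\<lambda>s. \<Sum>k\<le>m. of_real (cos (real k * t)) * (2 * inverse (circ \<rho> s) ^ k)) has_integral
     (\<Sum>k\<le>m. if k = 0 then 2 else 0)) {0..1}"
    by (intro has_integral_sum) auto
  from has_integral_diff[OF this has_integral_const_real[of "1::complex" 0 1]]
  show ?thesis by (simp add: cheb_kernel_trunc_def)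
qed

text \<open>Cauchy's formula for a convex set, with path derivative and denominator merged into
  \<open>cheb_kernel\<close>. The winding number stays in the statement, because the case of
  constant \<open>f\<close> is what determines it below.\<close>

lemma bernstein_ellipse_Cauchy:
  assumes "\<beta> > 0" "\<rho> = \<beta> + sqrt (1 + \<beta>\<^sup>2)" "f holomorphic_on stadium \<beta>"
  shows "((\<lambda>s. f (bernstein_ellipse \<rho> s) * cheb_kernel t (inverse (circ \<rho> s))) has_integral
    winding_number (bernstein_ellipse \<rho>) (of_real (cos t)) * f (of_real (cos t))) {0..1}"
proof -
  define \<gamma> where "\<gamma> = bernstein_ellipse \<rho>"
  define z where "z = complex_of_real (cos t)"
  have "sqrt (1 + \<beta>\<^sup>2) \<ge> 1" by simp
  then have \<rho>: "\<rho> > 1" using assms(1,2) by linarith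
  then have \<rho>0: "\<rho> > 0" by simp
  have kernel: "((circ \<rho> s - inverse (circ \<rho> s)) / 2) / (\<gamma> s - z) = cheb_kernel t (inverse (circ \<rho> s))"
    "\<gamma> s \<noteq> z" for s
    using joukowski_kernel[of "circ \<rho> s" t] circ_facts(2)[OF \<rho>0, of s] \<rho>
    by (simp_all add: \<gamma>_def z_def bernstein_ellipse_def)
  have "((\<lambda>w. f w / (w - z)) has_contour_integral (2*pi * \<i> * winding_number \<gamma> z * f z)) \<gamma>"
    using assms(3)
  proof (rule Cauchy_integral_formula_convex_simple[OF convex_stadium])
    show "z \<in> interior (stadium \<beta>)" unfolding z_def by (rule interior_stadium) (use assms in auto)
    show "valid_path \<gamma>" unfolding \<gamma>_def by (rule valid_path_bernstein_ellipse[OF \<rho>0])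
    show "path_image \<gamma> \<subseteq> stadium \<beta> - {z}"
      using kernel(2) bernstein_ellipse_in_stadium[OF assms(1,2), folded \<gamma>_def]
      unfolding path_image_def by blast
    show "pathfinish \<gamma> = pathstart \<gamma>" unfolding \<gamma>_def by (rule closed_bernstein_ellipse)
  qed
  then have "((\<lambda>s. f (\<gamma> s) / (\<gamma> s - z) * vector_derivative \<gamma> (at s within {0..1})) has_integral
      2 * of_real pi * \<i> * winding_number \<gamma> z * f z) {0..1}"
    by (simp add: has_contour_integral_def)
  then have int: "((\<lambda>s. (2 * of_real pi * \<i>) * (f (\<gamma> s) * cheb_kernel t (inverse (circ \<rho> s)))) has_integral
      2 * of_real pi * \<i> * winding_number \<gamma> z * f z) {0..1}"
  proof (rule has_integral_eq[rotated])
    fix s :: real assume s: "s \<in> {0..1}"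
    have "vector_derivative \<gamma> (at s within {0..1}) =
        2 * of_real pi * \<i> * ((circ \<rho> s - inverse (circ \<rho> s)) / 2)"
      unfolding \<gamma>_def using s bernstein_ellipse_derivative[OF \<rho>0]
      by (intro vector_derivative_within_closed_interval) auto
    moreover have "a / b * (c * d) = c * (a * (d / b))" for a b c d :: complex by simp
    ultimately show "f (\<gamma> s) / (\<gamma> s - z) * vector_derivative \<gamma> (at s within {0..1}) =
        (2 * of_real pi * \<i>) * (f (\<gamma> s) * cheb_kernel t (inverse (circ \<rho> s)))"
      by (simp only: kernel(1)[symmetric])
  qed
  define c where "c = 2 * complex_of_real pi * \<i>"
  have "c \<noteq> 0" by (simp add: c_def)
  then have cancel: "inverse c * (c * a) = a" for a by (simp flip: mult.assoc)
  show ?thesis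
    using has_integral_mult_right[OF int, of "inverse c"]
    unfolding c_def[symmetric] mult.assoc[of c] cancel \<gamma>_def z_def .
qed

lemma has_integral_norm_le:
  fixes f :: "real \<Rightarrow> complex"
  assumes "(f has_integral I) {0..1}" "0 \<le> B" "\<And>s. norm (f s) \<le> B"
  shows "norm I \<le> B"
  using has_integral_bound_real[OF assms(2) finite.emptyI assms(1)] assms(3) by simp

text \<open>Cauchy's formula with \<open>f = 1\<close> makes the winding number the integral of
  \<open>cheb_kernel\<close>. The truncated kernels have integral 1 for every \<open>m\<close>, and
  the remainder tends to 0 uniformly in \<open>s\<close>.\<close>

lemma winding_number_bernstein_ellipse:
  assumes "\<beta> > 0" "\<rho> = \<beta> + sqrt (1 + \<beta>\<^sup>2)"
  shows "winding_number (bernstein_ellipse \<rho>) (of_real (cos t)) = 1"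
proof -
  define n where "n = winding_number (bernstein_ellipse \<rho>) (of_real (cos t))"
  have "sqrt (1 + \<beta>\<^sup>2) \<ge> 1" by simp
  then have \<rho>: "\<rho> > 1" using assms by linarith
  then have \<rho>0: "\<rho> > 0" by simp
  have q: "inverse \<rho> < 1" "0 < inverse \<rho>" using \<rho> by (auto simp: inverse_less_1_iff)
  have "norm (n - 1) \<le> 2 * inverse \<rho> ^ (m + 1) / (1 - inverse \<rho>)" for m
  proof -
    have "((\<lambda>s. cheb_kernel t (inverse (circ \<rho> s)) - cheb_kernel_trunc m t (inverse (circ \<rho> s)))
        has_integral (n - 1)) {0..1}"
      using bernstein_ellipse_Cauchy[OF assms, of "\<lambda>_. 1" t] kernel_trunc_integral[OF \<rho>0]
      by (intro has_integral_diff) (auto simp: n_def)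
    then have "norm (n - 1) \<le> 2 * inverse \<rho> ^ (m + 1) / (1 - inverse \<rho>)"
    proof (rule has_integral_norm_le)
      fix s :: real
      show "norm (cheb_kernel t (inverse (circ \<rho> s)) - cheb_kernel_trunc m t (inverse (circ \<rho> s)))
          \<le> 2 * inverse \<rho> ^ (m + 1) / (1 - inverse \<rho>)"
        using norm_cheb_kernel_remainder[of "inverse (circ \<rho> s)" t m] q circ_facts(3)[OF \<rho>0] by simp
    qed (use q in auto)
    then show ?thesis by simp
  qed
  moreover have "(\<lambda>m. 2 * inverse \<rho> ^ (m + 1) / (1 - inverse \<rho>)) \<longlonglongrightarrow> 2 * 0 / (1 - inverse \<rho>)"
    by (intro tendsto_divide tendsto_mult tendsto_const LIMSEQ_Suc[unfolded Suc_eq_plus1] LIMSEQ_power_zero)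
      (use q in auto)
  ultimately have "norm (n - 1) \<le> 2 * 0 / (1 - inverse \<rho>)"
    by (intro LIMSEQ_le_const) auto
  then show ?thesis by (simp add: n_def)
qed

text \<open>The values of \<open>f\<close> at \<open>x\<close> and at all nodes are integrals over
  the same ellipse. In the difference of kernels the truncated parts drop out, leaving remainders of
  order \<open>1 / \<rho> ^ m\<close> weighted by 1 and by the Lagrange values, whence the factor
  \<open>cheb_lebesgue m + 1\<close>.\<close>

theorem cheb_interp_error:
  fixes f :: "complex \<Rightarrow> complex" and \<beta> M x :: real
  defines "\<rho> \<equiv> \<beta> + sqrt (1 + \<beta>\<^sup>2)"
  assumes \<beta>: "\<beta> > 0" and hol: "f holomorphic_on stadium \<beta>"
    and M: "\<And>z. z \<in> stadium \<beta> \<Longrightarrow> norm (f z) \<le> M"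
    and x: "-1 \<le> x" "x \<le> 1"
  shows "norm (f (of_real x) -
      (\<Sum>i\<le>m. of_real (cheb_lagrange m (-1) 1 i x) * f (of_real (cheb_point m i))))
    \<le> (cheb_lebesgue m + 1) * (2 * M / ((\<rho> - 1) * \<rho> ^ m))"
proof -
  define t where "t = arccos x"
  have xt: "x = cos t" using x by (simp add: t_def)
  define L where "L i = complex_of_real (cheb_lagrange m (-1) 1 i x)" for i
  define w where "w s = inverse (circ \<rho> s)" for s
  define R where "R t s = cheb_kernel t (w s) - cheb_kernel_trunc m t (w s)" for t s
  define \<gamma> where "\<gamma> = bernstein_ellipse \<rho>"
  have "sqrt (1 + \<beta>\<^sup>2) \<ge> 1" by simp
  then have \<rho>: "\<rho> > 1" using \<beta> unfolding \<rho>_def by linarith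
  then have \<rho>0: "\<rho> > 0" by simp
  have q: "inverse \<rho> < 1" "0 < inverse \<rho>" using \<rho> by (auto simp: inverse_less_1_iff)
  \<comment> \<open>The kernel remainder \<open>2 * q ^ (m + 1) / (1 - q)\<close> at
    \<open>q = 1 / \<rho>\<close>.\<close>
  define \<epsilon> where "\<epsilon> = 2 / ((\<rho> - 1) * \<rho> ^ m)"
  have \<epsilon>: "\<epsilon> \<ge> 0" using \<rho> by (simp add: \<epsilon>_def)
  have R: "norm (R t s) \<le> \<epsilon>" for t s
  proof -
    have "norm (R t s) \<le> 2 * inverse \<rho> ^ (m + 1) / (1 - inverse \<rho>)"
      using norm_cheb_kernel_remainder[of "w s" t m] q circ_facts(3)[OF \<rho>0] by (simp add: R_def w_def)
    also have "\<dots> = \<epsilon>" using \<rho> by (simp add: \<epsilon>_def field_simps power_inverse)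
    finally show ?thesis .
  qed
  have M0: "0 \<le> M"
    using M[of "of_real x"] interior_stadium[OF \<beta>, of x] x interior_subset[of "stadium \<beta>"]
    by (auto simp: abs_le_iff intro: order_trans[OF norm_ge_zero])
  have Cauchy: "((\<lambda>s. f (\<gamma> s) * cheb_kernel t (w s)) has_integral f (of_real (cos t))) {0..1}" for t
    using bernstein_ellipse_Cauchy[OF \<beta> \<rho>_def[THEN meta_eq_to_obj_eq] hol, of t]
    unfolding winding_number_bernstein_ellipse[OF \<beta> \<rho>_def[THEN meta_eq_to_obj_eq]] by (simp add: w_def \<gamma>_def)
  have "((\<lambda>s. f (\<gamma> s) * cheb_kernel t (w s) - (\<Sum>i\<le>m. L i * (f (\<gamma> s) * cheb_kernel (cheb_angle m i) (w s))))
      has_integral (f (of_real x) - (\<Sum>i\<le>m. L i * f (of_real (cheb_point m i))))) {0..1}"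
    unfolding xt cheb_point_eq_cos
    by (intro has_integral_diff has_integral_sum has_integral_mult_right Cauchy) auto
  then have "norm (f (of_real x) - (\<Sum>i\<le>m. L i * f (of_real (cheb_point m i))))
      \<le> (M * ((cheb_lebesgue m + 1) * \<epsilon>))"
  proof (rule has_integral_norm_le)
    fix s :: real
    \<comment> \<open>Interpolation at the nodes reproduces \<open>cheb_kernel_trunc\<close>, so
      only the remainders survive.\<close>
    have "cheb_kernel t (w s) - (\<Sum>i\<le>m. L i * cheb_kernel (cheb_angle m i) (w s)) =
       R t s - (\<Sum>i\<le>m. L i * R (cheb_angle m i) s)"
      using cheb_interp_kernel_trunc[of m t "w s"]
      by (simp add: R_def right_diff_distrib sum_subtractf L_def xt)
    also have "norm \<dots> \<le> \<epsilon> + (\<Sum>i\<le>m. norm (L i) * \<epsilon>)"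
      by (intro order_trans[OF norm_triangle_ineq4] add_mono order_trans[OF norm_sum] sum_mono R)
        (auto simp: norm_mult intro!: mult_left_mono R)
    also have "\<dots> = ((\<Sum>i\<le>m. norm (L i)) + 1) * \<epsilon>"
      by (simp add: distrib_right sum_distrib_right)
    also have "\<dots> \<le> (cheb_lebesgue m + 1) * \<epsilon>"
      using sum_abs_cheb_lagrange_le[OF x, of m] \<epsilon> by (intro mult_right_mono add_mono) (auto simp: L_def)
    finally have "norm (cheb_kernel t (w s) - (\<Sum>i\<le>m. L i * cheb_kernel (cheb_angle m i) (w s)))
       \<le> (cheb_lebesgue m + 1) * \<epsilon>" .
    moreover have "norm (f (\<gamma> s)) \<le> M"
      unfolding \<gamma>_def by (intro M bernstein_ellipse_in_stadium \<beta>) (simp add: \<rho>_def)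
    ultimately have "norm (f (\<gamma> s) * (cheb_kernel t (w s) - (\<Sum>i\<le>m. L i * cheb_kernel (cheb_angle m i) (w s))))
      \<le> M * ((cheb_lebesgue m + 1) * \<epsilon>)"
      unfolding norm_mult using M0 by (intro mult_mono) auto
    then show "norm (f (\<gamma> s) * cheb_kernel t (w s) -
        (\<Sum>i\<le>m. L i * (f (\<gamma> s) * cheb_kernel (cheb_angle m i) (w s)))) \<le> M * ((cheb_lebesgue m + 1) * \<epsilon>)"
      by (simp add: right_diff_distrib sum_distrib_left mult_ac)
  qed (use \<epsilon> M0 cheb_lebesgue_ge_1[of m] in auto)
  then show ?thesis by (simp add: L_def \<epsilon>_def mult_ac)
qed

section \<open>Tensor-product interpolation\<close>

lemma affine_parameter:
  fixes l u s :: real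
  assumes "l < u" "l \<le> s" "s \<le> u"
  obtains t where "-1 \<le> t" "t \<le> 1" "s = (l + u) / 2 + (u - l) / 2 * t"
proof
  show "-1 \<le> (2 * s - (l + u)) / (u - l)" "(2 * s - (l + u)) / (u - l) \<le> 1"
    "s = (l + u) / 2 + (u - l) / 2 * ((2 * s - (l + u)) / (u - l))"
    using assms by (simp_all add: field_simps)
qed

lemma sum_abs_cheb_lagrange_box_le:
  assumes "l < u" "l \<le> s" "s \<le> u"
  shows "(\<Sum>i\<le>m. \<bar>cheb_lagrange m l u i s\<bar>) \<le> cheb_lebesgue m"
proof -
  obtain t where "-1 \<le> t" "t \<le> 1" "s = (l + u) / 2 + (u - l) / 2 * t"
    using affine_parameter[OF assms] .
  then show ?thesis
    using sum_abs_cheb_lagrange_le[of t m] by (simp only: cheb_lagrange_affine[OF assms(1)])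
qed

lemma cheb_node_bounds:
  assumes "l < u"
  shows "l \<le> cheb_node m l u i" "cheb_node m l u i \<le> u"
proof -
  have "(u - l) / 2 * (- 1) \<le> (u - l) / 2 * cheb_point m i" "(u - l) / 2 * cheb_point m i \<le> (u - l) / 2 * 1"
    using assms cheb_point_bounds[of m i] by (intro mult_left_mono; simp)+
  then show "l \<le> cheb_node m l u i" "cheb_node m l u i \<le> u"
    by (simp_all add: cheb_node_def field_simps)
qed

section \<open>Interpolation in a subset of the coordinates\<close>

definition replace_coords :: "'a::euclidean_space set \<Rightarrow> ('a \<Rightarrow> real) \<Rightarrow> 'a \<Rightarrow> 'a" where
  "replace_coords K y x = (\<Sum>k\<in>Basis. (if k \<in> K then y k else x \<bullet> k) *\<^sub>R k)"

lemma inner_replace_coords: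
  "k \<in> Basis \<Longrightarrow> replace_coords K y x \<bullet> k = (if k \<in> K then y k else x \<bullet> k)"
  by (simp add: replace_coords_def inner_sum_left_Basis)

lemma replace_coords_insert:
  assumes "a \<in> Basis" "a \<notin> K"
  shows "replace_coords (insert a K) (y(a := s)) x =
    replace_coords K y x + (s - replace_coords K y x \<bullet> a) *\<^sub>R a"
proof (rule euclidean_eqI)
  fix k :: 'a assume "k \<in> Basis"
  then show "replace_coords (insert a K) (y(a := s)) x \<bullet> k =
      (replace_coords K y x + (s - replace_coords K y x \<bullet> a) *\<^sub>R a) \<bullet> k"
    using assms by (auto simp: inner_replace_coords inner_add_left inner_Basis)
qed

text \<open>Passes from the identity at \<open>K = {}\<close> to the tensor interpolant at
  \<open>K = Basis\<close>, so that the error can be accumulated by induction over the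
  coordinates.\<close>

definition cheb_interp_on ::
  "'a set \<Rightarrow> nat \<Rightarrow> 'a::euclidean_space \<Rightarrow> 'a \<Rightarrow> ('a \<Rightarrow> complex) \<Rightarrow> 'a \<Rightarrow> complex" where
  "cheb_interp_on K m l u f x =
     (\<Sum>\<nu>\<in>K \<rightarrow>\<^sub>E {..m}.
        complex_of_real (\<Prod>k\<in>K. cheb_lagrange m (l \<bullet> k) (u \<bullet> k) (\<nu> k) (x \<bullet> k)) *
        f (replace_coords K (\<lambda>k. cheb_node m (l \<bullet> k) (u \<bullet> k) (\<nu> k)) x))"

lemma cheb_interp_on_Basis: "cheb_interp_on Basis m l u f x = tensor_cheb_interp m l u f x"
  by (simp add: cheb_interp_on_def tensor_cheb_interp_def replace_coords_def)

lemma cheb_interp_on_empty: "cheb_interp_on {} m l u f x = f x"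
  by (simp add: cheb_interp_on_def replace_coords_def euclidean_representation)

text \<open>A multi-index on \<open>insert a K\<close> is a free choice at \<open>a\<close> together
  with a multi-index on \<open>K\<close>, so the sum factorises and direction \<open>a\<close> can
  be treated first. Its weights are taken at \<open>x\<close>, which has the same coordinate in
  direction \<open>a\<close> as every sample point of the interpolation in \<open>K\<close>.\<close>

lemma cheb_interp_on_insert:
  assumes "finite K" "a \<in> Basis" "a \<notin> K"
  shows "cheb_interp_on (insert a K) m l u f x =
    cheb_interp_on K m l u (\<lambda>y. \<Sum>i\<le>m. of_real (cheb_lagrange m (l \<bullet> a) (u \<bullet> a) i (x \<bullet> a)) *
      f (y + (cheb_node m (l \<bullet> a) (u \<bullet> a) i - y \<bullet> a) *\<^sub>R a)) x"
proof -
  define N where "N \<nu> = (\<lambda>k. cheb_node m (l \<bullet> k) (u \<bullet> k) (\<nu> k))" for \<nu> :: "'a \<Rightarrow> nat"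
  define L where "L k i = cheb_lagrange m (l \<bullet> k) (u \<bullet> k) i (x \<bullet> k)" for k i
  define h where "h \<nu> = complex_of_real (\<Prod>k\<in>insert a K. L k (\<nu> k)) *
    f (replace_coords (insert a K) (N \<nu>) x)" for \<nu>
  have "inj_on (\<lambda>(i, \<nu>). \<nu>(a := i)) ({..m} \<times> (K \<rightarrow>\<^sub>E {..m}))"
    using inj_combinator[OF assms(3), of "\<lambda>_. {..m}"] .
  then have "cheb_interp_on (insert a K) m l u f x = (\<Sum>(i, \<nu>)\<in>{..m} \<times> (K \<rightarrow>\<^sub>E {..m}). h (\<nu>(a := i)))"
    by (simp add: cheb_interp_on_def PiE_insert_eq sum.reindex h_def L_def N_def case_prod_unfold)
  also have "\<dots> = (\<Sum>\<nu>\<in>K \<rightarrow>\<^sub>E {..m}. \<Sum>i\<le>m. h (\<nu>(a := i)))"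
    by (subst sum.swap) (simp add: sum.cartesian_product)
  also have "\<dots> = (\<Sum>\<nu>\<in>K \<rightarrow>\<^sub>E {..m}. of_real (\<Prod>k\<in>K. L k (\<nu> k)) * (\<Sum>i\<le>m. of_real (L a i) *
      f (replace_coords K (N \<nu>) x + (cheb_node m (l \<bullet> a) (u \<bullet> a) i - replace_coords K (N \<nu>) x \<bullet> a) *\<^sub>R a)))"
  proof (rule sum.cong[OF refl])
    fix \<nu>
    have "h (\<nu>(a := i)) = of_real (\<Prod>k\<in>K. L k (\<nu> k)) * (of_real (L a i) *
      f (replace_coords K (N \<nu>) x + (cheb_node m (l \<bullet> a) (u \<bullet> a) i - replace_coords K (N \<nu>) x \<bullet> a) *\<^sub>R a))" for i
    proof -
      have "(\<Prod>k\<in>K. L k ((\<nu>(a := i)) k)) = (\<Prod>k\<in>K. L k (\<nu> k))"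
        by (rule prod.cong) (use assms in auto)
      moreover have "N (\<nu>(a := i)) = (N \<nu>)(a := cheb_node m (l \<bullet> a) (u \<bullet> a) i)"
        by (auto simp: N_def)
      ultimately show ?thesis
        using assms by (simp add: h_def replace_coords_insert mult_ac)
    qed
    then show "(\<Sum>i\<le>m. h (\<nu>(a := i))) = of_real (\<Prod>k\<in>K. L k (\<nu> k)) * (\<Sum>i\<le>m. of_real (L a i) *
      f (replace_coords K (N \<nu>) x + (cheb_node m (l \<bullet> a) (u \<bullet> a) i - replace_coords K (N \<nu>) x \<bullet> a) *\<^sub>R a))"
      by (simp only: sum_distrib_left)
  qed
  finally show ?thesis by (simp add: cheb_interp_on_def L_def N_def)
qed

lemma cheb_interp_on_diff:
  "cheb_interp_on K m l u f x - cheb_interp_on K m l u g x = cheb_interp_on K m l u (\<lambda>y. f y - g y) x"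
  by (simp add: cheb_interp_on_def right_diff_distrib sum_subtractf)

text \<open>The points at which \<open>f\<close> is sampled share with \<open>x\<close> the coordinates outside \<open>K\<close>.\<close>

lemma norm_cheb_interp_on_le:
  fixes l u x :: "'a::euclidean_space"
  assumes K: "K \<subseteq> Basis" and lu: "\<And>k. k \<in> Basis \<Longrightarrow> l \<bullet> k < u \<bullet> k" and x: "x \<in> cbox l u"
    and f: "\<And>y. y \<in> cbox l u \<Longrightarrow> (\<And>k. k \<in> Basis - K \<Longrightarrow> y \<bullet> k = x \<bullet> k) \<Longrightarrow> norm (f y) \<le> E"
    and E: "0 \<le> E"
  shows "norm (cheb_interp_on K m l u f x) \<le> cheb_lebesgue m ^ card K * E"
proof -
  define L where "L k i = cheb_lagrange m (l \<bullet> k) (u \<bullet> k) i (x \<bullet> k)" for k i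
  have fin: "finite K" using K finite_Basis finite_subset by blast
  have lx: "l \<bullet> k \<le> x \<bullet> k" "x \<bullet> k \<le> u \<bullet> k" if "k \<in> Basis" for k
    using x that by (auto simp: mem_box)
  have "norm (cheb_interp_on K m l u f x) \<le> (\<Sum>\<nu>\<in>K \<rightarrow>\<^sub>E {..m}. (\<Prod>k\<in>K. \<bar>L k (\<nu> k)\<bar>) * E)"
    unfolding cheb_interp_on_def
  proof (rule sum_norm_le)
    fix \<nu>
    define r where "r = replace_coords K (\<lambda>k. cheb_node m (l \<bullet> k) (u \<bullet> k) (\<nu> k)) x"
    have "norm (f r) \<le> E"
    proof (rule f)
      show "r \<in> cbox l u"
        using lx lu cheb_node_bounds by (auto simp: mem_box r_def inner_replace_coords)
    qed (simp add: r_def inner_replace_coords)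
    then show "norm (complex_of_real (\<Prod>k\<in>K. cheb_lagrange m (l \<bullet> k) (u \<bullet> k) (\<nu> k) (x \<bullet> k)) *
        f (replace_coords K (\<lambda>k. cheb_node m (l \<bullet> k) (u \<bullet> k) (\<nu> k)) x)) \<le> (\<Prod>k\<in>K. \<bar>L k (\<nu> k)\<bar>) * E"
      by (simp add: norm_mult r_def L_def abs_prod mult_left_mono prod_nonneg flip: of_real_prod)
  qed
  \<comment> \<open>The sum of products over all multi-indices factorises into a product of
    univariate Lebesgue functions.\<close>
  also have "\<dots> = (\<Prod>k\<in>K. \<Sum>i\<le>m. \<bar>L k i\<bar>) * E"
    using fin by (simp add: prod_sum_PiE sum_distrib_right)
  also have "(\<Prod>k\<in>K. \<Sum>i\<le>m. \<bar>L k i\<bar>) \<le> (\<Prod>k\<in>K. cheb_lebesgue m)"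
    unfolding L_def using K lu lx
    by (intro prod_mono conjI sum_nonneg sum_abs_cheb_lagrange_box_le) auto
  finally show ?thesis using E by (simp add: mult_right_mono)
qed

text \<open>Directions are added one at a time. Adding \<open>a\<close> changes the interpolant by
  the \<open>K\<close>-interpolant of a univariate error, which costs at most
  \<open>cheb_lebesgue m ^ card K * E\<close>; as the Lebesgue constant is at least 1, the last of
  these summands is the largest.\<close>

theorem tensor_cheb_interp_error:
  fixes l u x :: "'a::euclidean_space"
  assumes lu: "\<And>k. k \<in> Basis \<Longrightarrow> l \<bullet> k < u \<bullet> k" and x: "x \<in> cbox l u"
    and err: "\<And>y k. y \<in> cbox l u \<Longrightarrow> k \<in> Basis \<Longrightarrow>
      norm (f y - (\<Sum>i\<le>m. of_real (cheb_lagrange m (l \<bullet> k) (u \<bullet> k) i (y \<bullet> k)) *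
        f (y + (cheb_node m (l \<bullet> k) (u \<bullet> k) i - y \<bullet> k) *\<^sub>R k))) \<le> E"
  shows "norm (f x - tensor_cheb_interp m l u f x) \<le>
    real DIM('a) * cheb_lebesgue m ^ (DIM('a) - 1) * E"
proof -
  obtain k0 :: 'a where "k0 \<in> Basis" using nonempty_Basis by blast
  then have E: "0 \<le> E" using err[OF x] norm_ge_zero order_trans by blast
  have \<Lambda>: "cheb_lebesgue m \<ge> 1" by (rule cheb_lebesgue_ge_1)
  have "norm (f x - cheb_interp_on K m l u f x) \<le> (\<Sum>j<card K. cheb_lebesgue m ^ j * E)"
    if "K \<subseteq> Basis" for K
    using finite_subset[OF that finite_Basis] that
  proof (induction K rule: finite_induct)
    case empty
    then show ?case by (simp add: cheb_interp_on_empty)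
  next
    case (insert a K)
    define g where "g y = (\<Sum>i\<le>m. of_real (cheb_lagrange m (l \<bullet> a) (u \<bullet> a) i (x \<bullet> a)) *
      f (y + (cheb_node m (l \<bullet> a) (u \<bullet> a) i - y \<bullet> a) *\<^sub>R a))" for y
    have "norm (cheb_interp_on K m l u (\<lambda>y. f y - g y) x) \<le> cheb_lebesgue m ^ card K * E"
    proof (rule norm_cheb_interp_on_le[OF _ lu x _ E])
      fix y assume y: "y \<in> cbox l u" "\<And>k. k \<in> Basis - K \<Longrightarrow> y \<bullet> k = x \<bullet> k"
      \<comment> \<open>As \<open>a\<close> lies outside \<open>K\<close>, the weights in
        \<open>g\<close>, taken at \<open>x\<close>, are those of the univariate interpolant at
        \<open>y\<close>, and \<open>err\<close> applies.\<close>
      then have "y \<bullet> a = x \<bullet> a" using insert by auto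
      then show "norm (f y - g y) \<le> E" using err[OF y(1), of a] insert by (simp add: g_def)
    qed (use insert in auto)
    moreover have "f x - cheb_interp_on (insert a K) m l u f x =
        (f x - cheb_interp_on K m l u f x) + cheb_interp_on K m l u (\<lambda>y. f y - g y) x"
      using insert by (simp add: cheb_interp_on_insert g_def flip: cheb_interp_on_diff)
    ultimately have "norm (f x - cheb_interp_on (insert a K) m l u f x) \<le>
        (\<Sum>j<card K. cheb_lebesgue m ^ j * E) + cheb_lebesgue m ^ card K * E"
      using insert.IH insert.prems norm_triangle_mono by (metis insert_subset)
    then show ?case using insert by simp
  qed
  from this[of Basis] have "norm (f x - tensor_cheb_interp m l u f x) \<le>
      (\<Sum>j<DIM('a). cheb_lebesgue m ^ j * E)"
    by (simp add: cheb_interp_on_Basis)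
  also have "\<dots> \<le> (\<Sum>j<DIM('a). cheb_lebesgue m ^ (DIM('a) - 1) * E)"
    using \<Lambda> E by (intro sum_mono mult_right_mono power_increasing) auto
  finally show ?thesis by simp
qed

section \<open>The holomorphic extension of the modified kernel\<close>

text \<open>The squared distance of the unit vectors is
  \<open>2 - 2 * (v \<bullet> w) / (a * b)\<close>; multiplying by \<open>a * b\<close> and using
  \<open>2 * a * b \<le> a\<^sup>2 + b\<^sup>2\<close> leaves the squared distance of
  \<open>v\<close> and \<open>w\<close>. It serves to compare the direction of \<open>x - y\<close>
  with that of the centers.\<close>

lemma norm_sgn_diff_le:
  fixes v w :: "'a::real_inner"
  assumes "\<delta> > 0" "\<delta> \<le> norm v" "\<delta> \<le> norm w"
  shows "norm (v /\<^sub>R norm v - w /\<^sub>R norm w) \<le> norm (v - w) / \<delta>"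
proof -
  define a b where "a = norm v" and "b = norm w"
  have ab: "a > 0" "b > 0" "\<delta> \<le> a" "\<delta> \<le> b" using assms by (auto simp: a_def b_def)
  define D where "D = norm (v /\<^sub>R a - w /\<^sub>R b)"
  have vv: "v \<bullet> v = a\<^sup>2" "w \<bullet> w = b\<^sup>2" by (simp_all add: a_def b_def power2_norm_eq_inner)
  have "D\<^sup>2 = 2 - 2 * (v \<bullet> w) / (a * b)"
    using ab unfolding D_def power2_norm_eq_inner inner_diff_left inner_diff_right
    by (simp add: vv inner_commute[of w v] power2_eq_square field_simps)
  then have "D\<^sup>2 * (a * b) = 2 * (a * b) - 2 * (v \<bullet> w)"
    using ab by (simp add: field_simps)
  also have "\<dots> \<le> a\<^sup>2 + b\<^sup>2 - 2 * (v \<bullet> w)" using sum_squares_bound[of a b] by simp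
  also have "\<dots> = (norm (v - w))\<^sup>2"
    unfolding power2_norm_eq_inner inner_diff_left inner_diff_right by (simp add: vv inner_commute[of w v])
  finally have "D\<^sup>2 * (a * b) \<le> (norm (v - w))\<^sup>2" .
  moreover have "D\<^sup>2 * \<delta>\<^sup>2 \<le> D\<^sup>2 * (a * b)"
    unfolding power2_eq_square[of \<delta>] using ab assms by (intro mult_left_mono mult_mono) auto
  ultimately have "(D * \<delta>)\<^sup>2 \<le> (norm (v - w))\<^sup>2" unfolding power_mult_distrib by linarith
  then have "D * \<delta> \<le> norm (v - w)" by (rule power2_le_imp_le) simp
  then show ?thesis using assms(1) by (simp add: D_def a_def b_def pos_le_divide_eq)
qed

text \<open>The squared norm of \<open>z + t p\<close>, continued bilinearly rather than as a
  Hermitian form, which makes it a polynomial in the complex variable \<open>t\<close>.\<close>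

definition sqnorm_ext :: "'a::real_inner \<Rightarrow> 'a \<Rightarrow> complex \<Rightarrow> complex" where
  "sqnorm_ext z p t = of_real (z \<bullet> z) + 2 * t * of_real (z \<bullet> p) + t\<^sup>2 * of_real (p \<bullet> p)"

lemma sqnorm_ext_of_real: "sqnorm_ext z p (of_real x) = of_real ((norm (z + x *\<^sub>R p))\<^sup>2)"
proof -
  have "(norm (z + x *\<^sub>R p))\<^sup>2 = z \<bullet> z + 2 * x * (z \<bullet> p) + x\<^sup>2 * (p \<bullet> p)"
    unfolding power2_norm_eq_inner
    by (simp add: inner_add inner_commute[of p z] algebra_simps power2_eq_square)
  then show ?thesis by (simp only: sqnorm_ext_def of_real_add of_real_mult of_real_power of_real_numeral)
qed

text \<open>Absorbs the real number \<open>x\<close> into the base point, so that estimates are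
  needed only for a small increment \<open>\<tau>\<close>.\<close>

lemma sqnorm_ext_shift: "sqnorm_ext z p (of_real x + \<tau>) = sqnorm_ext (z + x *\<^sub>R p) p \<tau>"
  by (simp add: sqnorm_ext_def inner_add inner_commute[of p z] algebra_simps power2_eq_square)

text \<open>\<open>w\<close> stays close to the positive number \<open>R\<^sup>2\<close>, hence away
  from the branch cut. The first-order expansion \<open>y\<close> satisfies \<open>w - y\<^sup>2 =
  \<tau>\<^sup>2 * ((norm p)\<^sup>2 - s\<^sup>2)\<close>, and dividing by
  \<open>csqrt w + y\<close> yields the quadratic error.\<close>

lemma csqrt_sqnorm_ext_estimates:
  fixes z p :: "'a::real_inner"
  defines "R \<equiv> norm z"
  assumes z: "z \<noteq> 0" and e: "norm \<tau> * norm p \<le> 9 / 40 * R"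
  defines "w \<equiv> sqnorm_ext z p \<tau>"
  shows "0 < Re w" "7 / 10 * R \<le> Re (csqrt w)"
    "norm (csqrt w - (of_real R + \<tau> * of_real (z \<bullet> p / R))) \<le> (norm \<tau> * norm p)\<^sup>2 / (7 / 5 * R)"
proof -
  define e where "e = norm \<tau> * norm p"
  have R: "R > 0" using z by (simp add: R_def)
  have e0: "0 \<le> e" "e \<le> 9 / 40 * R" using e by (auto simp: e_def)
  have zp: "\<bar>z \<bullet> p\<bar> \<le> R * norm p" using Cauchy_Schwarz_ineq2 by (simp add: R_def)
  have "norm (w - of_real (R\<^sup>2)) = norm (2 * \<tau> * of_real (z \<bullet> p) + \<tau>\<^sup>2 * of_real (p \<bullet> p))"
    by (simp add: w_def sqnorm_ext_def R_def power2_norm_eq_inner)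
  also have "\<dots> \<le> 2 * norm \<tau> * \<bar>z \<bullet> p\<bar> + (norm \<tau>)\<^sup>2 * (norm p)\<^sup>2"
    by (intro order_trans[OF norm_triangle_ineq]) (simp add: norm_mult norm_power power2_norm_eq_inner)
  also have "\<dots> \<le> 2 * norm \<tau> * (R * norm p) + (norm \<tau>)\<^sup>2 * (norm p)\<^sup>2"
    using zp by (intro add_mono mult_left_mono) auto
  also have "\<dots> = 2 * R * e + e\<^sup>2" by (simp add: e_def power_mult_distrib)
  also have "\<dots> \<le> 2 * R * (9 / 40 * R) + (9 / 40 * R)\<^sup>2"
    using R e0 by (intro add_mono mult_left_mono power_mono) auto
  also have "\<dots> = 801 / 1600 * R\<^sup>2" by (simp add: power2_eq_square)
  finally have "\<bar>Re (w - of_real (R\<^sup>2))\<bar> \<le> 801 / 1600 * R\<^sup>2"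
    using abs_Re_le_cmod order_trans by blast
  then have "R\<^sup>2 - Re w \<le> 801 / 1600 * R\<^sup>2" unfolding abs_le_iff by simp
  \<comment> \<open>\<open>1 - 801 / 1600\<close> exceeds \<open>49 / 100\<close>, which is the
    square of \<open>7 / 10\<close>.\<close>
  then have Rew: "49 / 100 * R\<^sup>2 \<le> Re w" using zero_le_power2[of R] by linarith
  show w0: "0 < Re w" using Rew R by (smt (verit) zero_less_power mult_pos_pos divide_pos_pos)
  define r where "r = csqrt w"
  have r2: "r\<^sup>2 = w" by (simp add: r_def)
  have Rer: "0 \<le> Re r" using csqrt_principal[of w] by (auto simp: r_def)
  have "(7 / 10 * R)\<^sup>2 \<le> (Re r)\<^sup>2"
  proof -
    have "Re w = (Re r)\<^sup>2 - (Im r)\<^sup>2" unfolding r2[symmetric] by (simp add: power2_eq_square)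
    then have "Re w \<le> (Re r)\<^sup>2" by simp
    moreover have "(7 / 10 * R)\<^sup>2 = 49 / 100 * R\<^sup>2" by (simp add: power2_eq_square)
    ultimately show ?thesis using Rew by linarith
  qed
  then show Rr: "7 / 10 * R \<le> Re (csqrt w)" using Rer unfolding r_def[symmetric] by (rule power2_le_imp_le)
  define s where "s = z \<bullet> p / R"
  define y where "y = of_real R + \<tau> * of_real s"
  have s: "\<bar>s\<bar> \<le> norm p" using zp R by (simp add: s_def abs_divide divide_le_eq mult.commute)
  have "norm (\<tau> * of_real s) \<le> e"
    unfolding norm_mult e_def using s by (intro mult_mono) auto
  then have "\<bar>Re (\<tau> * of_real s)\<bar> \<le> 9 / 40 * R"
    using abs_Re_le_cmod[of "\<tau> * of_real s"] e0 by linarith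
  \<comment> \<open>The real parts of \<open>r\<close> and \<open>y\<close> are at least
    \<open>7 / 10 * R\<close> and \<open>31 / 40 * R\<close>.\<close>
  then have "7 / 5 * R \<le> Re (r + y)" using Rr R by (simp add: y_def r_def abs_le_iff)
  also have "\<dots> \<le> norm (r + y)" by (rule complex_Re_le_cmod)
  finally have ry: "7 / 5 * R \<le> norm (r + y)" .
  have "w - y\<^sup>2 = \<tau>\<^sup>2 * of_real ((norm p)\<^sup>2 - s\<^sup>2)"
  proof -
    have "R * s = z \<bullet> p" using R by (simp add: s_def)
    then have "of_real R * of_real s = complex_of_real (z \<bullet> p)" by (metis of_real_mult)
    moreover have "z \<bullet> z = R\<^sup>2" "p \<bullet> p = (norm p)\<^sup>2" by (simp_all add: R_def power2_norm_eq_inner)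
    ultimately show ?thesis
      unfolding w_def sqnorm_ext_def y_def by (simp add: algebra_simps power2_eq_square)
  qed
  then have "norm ((r - y) * (r + y)) = (norm \<tau>)\<^sup>2 * \<bar>(norm p)\<^sup>2 - s\<^sup>2\<bar>"
    unfolding r2[symmetric]
    by (simp add: norm_mult norm_power power2_eq_square algebra_simps flip: of_real_mult of_real_diff)
  also have "\<dots> \<le> (norm \<tau>)\<^sup>2 * (norm p)\<^sup>2"
  proof (rule mult_left_mono)
    have "s\<^sup>2 \<le> (norm p)\<^sup>2" using s by (metis abs_norm_cancel abs_le_square_iff)
    then show "\<bar>(norm p)\<^sup>2 - s\<^sup>2\<bar> \<le> (norm p)\<^sup>2" by simp
  qed simp
  finally have "norm (r - y) * norm (r + y) \<le> e\<^sup>2" by (simp add: e_def norm_mult power_mult_distrib)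
  moreover have "norm (r - y) * (7 / 5 * R) \<le> norm (r - y) * norm (r + y)"
    using ry by (intro mult_left_mono) auto
  ultimately have "norm (r - y) * (7 / 5 * R) \<le> e\<^sup>2" by linarith
  then show "norm (csqrt w - (of_real R + \<tau> * of_real (z \<bullet> p / R))) \<le> (norm \<tau> * norm p)\<^sup>2 / (7 / 5 * R)"
    using R unfolding r_def y_def e_def s_def by (simp only: pos_le_divide_eq mult_pos_pos zero_less_divide_iff zero_less_numeral simp_thms)
qed

section \<open>The extended kernel and its growth\<close>

definition G_dir_ext :: "complex \<Rightarrow> real^3 \<Rightarrow> real^3 \<Rightarrow> real^3 \<Rightarrow> complex \<Rightarrow> complex" where
  "G_dir_ext \<zeta> c z p t =
     exp (- of_real (Re \<zeta>) * csqrt (sqnorm_ext z p t)) *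
     exp (- \<i> * of_real (Im \<zeta>) * (csqrt (sqnorm_ext z p t) - (of_real (z \<bullet> c) + t * of_real (p \<bullet> c)))) /
     (4 * of_real pi * csqrt (sqnorm_ext z p t))"

lemma G_dir_ext_of_real: "G_dir_ext \<zeta> c z p (of_real x) = G_dir \<zeta> c (z + x *\<^sub>R p)"
  unfolding G_dir_ext_def G_dir_def sqnorm_ext_of_real
  by (simp add: exp_of_real[symmetric] inner_add_left csqrt_of_real_nonneg mult.assoc del: of_real_power)

text \<open>Here \<open>q\<close> bounds the diameters, \<open>\<delta>\<close> is the distance of the boxes, and \<open>M\<close> the difference of
  their centers; the phase is expanded around the real point \<open>z\<close>.\<close>

lemma phase_bound:
  fixes z p c M :: "'a::real_inner" and \<tau> :: complex
  assumes \<delta>: "0 < \<delta>" "\<delta> \<le> norm z" "\<delta> \<le> norm M" and zM: "norm (z - M) \<le> q"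
    and p: "norm p \<le> q / 2" and \<tau>: "norm \<tau> \<le> \<beta>" and \<beta>: "\<beta> \<le> 1" and \<beta>q: "\<beta> * q \<le> 9 / 20 * \<delta>"
  shows "\<bar>Im (csqrt (sqnorm_ext z p \<tau>) - \<tau> * of_real (p \<bullet> c))\<bar> \<le>
    7 / 10 * (\<beta> * q\<^sup>2 / \<delta>) + q / 2 * norm (M /\<^sub>R norm M - c)"
proof -
  define R where "R = norm z"
  define d where "d = M /\<^sub>R norm M"
  define r where "r = csqrt (sqnorm_ext z p \<tau>)"
  define y where "y = of_real R + \<tau> * of_real (z \<bullet> p / R)"
  have R: "0 < R" "\<delta> \<le> R" using \<delta> by (auto simp: R_def)
  have q: "0 \<le> q" and \<beta>0: "0 \<le> \<beta>" using zM \<tau> norm_ge_zero order_trans by blast+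
  have e: "norm \<tau> * norm p \<le> \<beta> * (q / 2)" using p \<tau> q \<beta>0 by (intro mult_mono) auto
  then have "norm \<tau> * norm p \<le> 9 / 40 * norm z" using \<beta>q \<delta> by simp
  from csqrt_sqnorm_ext_estimates(3)[OF _ this] R
  have "norm (r - y) \<le> (norm \<tau> * norm p)\<^sup>2 / (7 / 5 * R)" by (auto simp: r_def y_def R_def)
  also have "\<dots> \<le> (\<beta> * (q / 2))\<^sup>2 / (7 / 5 * \<delta>)"
    using e R \<delta> by (intro frac_le power_mono) auto
  \<comment> \<open>\<open>5 / 28\<close> is \<open>(1 / 2)\<^sup>2 / (7 / 5)\<close>. One factor
    \<open>\<beta>\<close> is split off and then dropped by \<open>\<beta> \<le> 1\<close>, to match
    the form of the linear term.\<close>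
  also have "\<dots> = 5 / 28 * (\<beta> * (\<beta> * q\<^sup>2 / \<delta>))" by (simp add: power2_eq_square field_simps)
  also have "\<dots> \<le> 5 / 28 * (\<beta> * q\<^sup>2 / \<delta>)"
    using \<beta> \<beta>0 \<delta> by (intro mult_left_mono mult_left_le_one_le) auto
  finally have "\<bar>Im (r - y)\<bar> \<le> 5 / 28 * (\<beta> * q\<^sup>2 / \<delta>)" using abs_Im_le_cmod order_trans by blast
  moreover have "\<bar>Im (y - \<tau> * of_real (p \<bullet> c))\<bar> \<le> 1 / 2 * (\<beta> * q\<^sup>2 / \<delta>) + q / 2 * norm (d - c)"
  proof -
    have 1: "norm (z /\<^sub>R R - d) \<le> q / \<delta>"
      using norm_sgn_diff_le[OF \<delta>] divide_right_mono[OF zM, of \<delta>] \<delta>(1) by (simp add: R_def d_def)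
    \<comment> \<open>As \<open>R\<close> is real, only \<open>Im \<tau>\<close> enters. The
      direction \<open>d\<close> of the centers is inserted between \<open>z / R\<close> and
      \<open>c\<close>: the first gap is bounded geometrically, the second is kept for the
      directional admissibility condition.\<close>
    have "Im (y - \<tau> * of_real (p \<bullet> c)) = Im \<tau> * (z \<bullet> p / R - p \<bullet> c)"
      by (simp add: y_def algebra_simps del: of_real_divide)
    also have "z \<bullet> p / R - p \<bullet> c = p \<bullet> (z /\<^sub>R R - d) + p \<bullet> (d - c)"
      by (simp add: inner_diff_right inner_commute[of z p] divide_inverse)
    also have "\<bar>Im \<tau> * \<dots>\<bar> = \<bar>Im \<tau>\<bar> * \<bar>p \<bullet> (z /\<^sub>R R - d) + p \<bullet> (d - c)\<bar>" by (simp only: abs_mult)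
    also have "\<dots> \<le> \<beta> * (q / 2 * (q / \<delta>) + q / 2 * norm (d - c))"
    proof (intro mult_mono order_trans[OF abs_triangle_ineq] add_mono)
      show "\<bar>Im \<tau>\<bar> \<le> \<beta>" using abs_Im_le_cmod \<tau> order_trans by blast
      show "\<bar>p \<bullet> (z /\<^sub>R R - d)\<bar> \<le> q / 2 * (q / \<delta>)"
        using 1 p q by (intro order_trans[OF Cauchy_Schwarz_ineq2] mult_mono) auto
      show "\<bar>p \<bullet> (d - c)\<bar> \<le> q / 2 * norm (d - c)"
        using p q by (intro order_trans[OF Cauchy_Schwarz_ineq2] mult_mono) auto
    qed (use \<beta>0 in auto)
    also have "\<dots> = 1 / 2 * (\<beta> * q\<^sup>2 / \<delta>) + \<beta> * (q / 2 * norm (d - c))"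
      by (simp add: power2_eq_square algebra_simps)
    also have "\<beta> * (q / 2 * norm (d - c)) \<le> q / 2 * norm (d - c)"
      using \<beta> \<beta>0 q by (intro mult_left_le_one_le) auto
    finally show ?thesis by simp
  qed
  \<comment> \<open>Allows the constants to be rounded:
    \<open>5 / 28 + 1 / 2 = 19 / 28 \<le> 7 / 10\<close>.\<close>
  moreover have "0 \<le> \<beta> * q\<^sup>2 / \<delta>" using \<beta>0 \<delta> by simp
  moreover have "Im (r - \<tau> * of_real (p \<bullet> c)) = Im (r - y) + Im (y - \<tau> * of_real (p \<bullet> c))" by simp
  ultimately show ?thesis unfolding r_def[symmetric] d_def[symmetric] by linarith
qed

text \<open>The modulus is the exponential of \<open>- Re \<zeta> * Re r + Im \<zeta> * ph\<close>
  over \<open>4 * pi * norm r\<close>. The root keeps at least \<open>7 / 10\<close> of the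
  distance, both in the decay and in the denominator; the phase growth is at most a constant or is
  absorbed by part of the decay.\<close>

lemma norm_G_dir_ext_le:
  fixes z p c M :: "real^3" and \<tau> :: complex
  assumes \<zeta>: "0 < Re \<zeta>" and \<eta>: "0 < \<eta>1" "0 < \<eta>2" "0 < \<eta>3" "\<eta>3 < 1"
    and \<delta>: "0 < \<delta>" "\<delta> \<le> norm (z + x *\<^sub>R p)" "\<delta> \<le> norm M" and zM: "norm (z + x *\<^sub>R p - M) \<le> q"
    and p: "norm p \<le> q / 2" and \<tau>: "norm \<tau> \<le> \<beta>" and \<beta>: "\<beta> \<le> 1" "\<beta> * \<eta>2 \<le> 9 / 20"
    and q: "0 < q" and q\<delta>: "q \<le> \<eta>2 * \<delta>"
    and dir: "\<bar>Im \<zeta>\<bar> * norm (M /\<^sub>R norm M - c) \<le> \<eta>1 / q"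
    and par: "\<bar>Im \<zeta>\<bar> * q\<^sup>2 \<le> max \<eta>2 (\<eta>3 * Re \<zeta> * \<delta>) * \<delta>"
  shows "norm (G_dir_ext \<zeta> c z p (of_real x + \<tau>)) \<le>
    4 * exp \<eta>1 * (exp (- ((1 - \<eta>3) / 2) * Re \<zeta> * \<delta>) / (4 * pi * \<delta>))"
proof -
  define k where "k = Re \<zeta>"
  define v where "v = z + x *\<^sub>R p"
  define r where "r = csqrt (sqnorm_ext v p \<tau>)"
  define ph where "ph = Im (r - \<tau> * of_real (p \<bullet> c))"
  have \<beta>0: "0 \<le> \<beta>" using \<tau> norm_ge_zero order_trans by blast
  have v: "v \<noteq> 0" "\<delta> \<le> norm v" using \<delta> by (auto simp: v_def)
  have "\<beta> * q \<le> \<beta> * (\<eta>2 * \<delta>)" using q\<delta> \<beta>0 by (rule mult_left_mono)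
  also have "\<dots> \<le> 9 / 20 * \<delta>" using mult_right_mono[OF \<beta>(2), of \<delta>] \<delta> by (simp add: mult.assoc)
  finally have \<beta>q: "\<beta> * q \<le> 9 / 20 * \<delta>" .
  have "norm \<tau> * norm p \<le> \<beta> * (q / 2)" using p \<tau> q \<beta>0 by (intro mult_mono) auto
  then have e: "norm \<tau> * norm p \<le> 9 / 40 * norm v" using \<beta>q v by simp
  have Rer: "7 / 10 * \<delta> \<le> Re r"
    using csqrt_sqnorm_ext_estimates(2)[OF v(1) e] v(2) by (simp add: r_def)
  have Im_ph: "Im \<zeta> * ph \<le> 7 / 10 * (\<beta> * (\<bar>Im \<zeta>\<bar> * q\<^sup>2 / \<delta>)) + \<eta>1 / 2"
  proof -
    have "Im \<zeta> * ph \<le> \<bar>Im \<zeta>\<bar> * \<bar>ph\<bar>" by (metis abs_ge_self abs_mult)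
    also have "\<dots> \<le> \<bar>Im \<zeta>\<bar> * (7 / 10 * (\<beta> * q\<^sup>2 / \<delta>) + q / 2 * norm (M /\<^sub>R norm M - c))"
      unfolding ph_def r_def using phase_bound[OF \<delta>(1) v(2) \<delta>(3) _ p \<tau> \<beta>(1) \<beta>q, of c] zM
      by (intro mult_left_mono) (auto simp: v_def)
    also have "\<dots> = 7 / 10 * (\<beta> * (\<bar>Im \<zeta>\<bar> * q\<^sup>2 / \<delta>)) + q / 2 * (\<bar>Im \<zeta>\<bar> * norm (M /\<^sub>R norm M - c))"
      by (simp add: algebra_simps)
    also have "q / 2 * (\<bar>Im \<zeta>\<bar> * norm (M /\<^sub>R norm M - c)) \<le> q / 2 * (\<eta>1 / q)"
      using dir q by (intro mult_left_mono) auto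
    finally show ?thesis using q by simp
  qed
  have kRe: "7 / 10 * (k * \<delta>) \<le> k * Re r"
    using mult_left_mono[OF Rer, of k] \<zeta> by (simp add: k_def mult_ac)
  have k\<delta>: "0 < k * \<delta>" using \<zeta> \<delta> by (simp add: k_def)
  have decay: "- ((1 - \<eta>3) / 2) * k * \<delta> = (\<eta>3 * (k * \<delta>) - k * \<delta>) / 2" by (simp add: field_simps)
  define Q T where "Q = \<beta> * (\<bar>Im \<zeta>\<bar> * q\<^sup>2 / \<delta>)" and "T = k * \<delta>"
  define K X U where "K = k * Re r" and "X = Im \<zeta> * ph" and "U = \<eta>3 * T"
  have neg: "- k * Re r = - (k * Re r)" by simp
  have exponent: "- k * Re r + Im \<zeta> * ph \<le> - ((1 - \<eta>3) / 2) * k * \<delta> + (1 / 2 + \<eta>1)"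
  \<comment> \<open>The cases are the two entries of \<open>max\<close> in \<open>par\<close>. If
    \<open>\<eta>2\<close> is the larger, the growth is at most
    \<open>7 / 10 * 9 / 20 < 1 / 2\<close> plus the directional part. Otherwise it is at most
    \<open>7 / 10 * U\<close> plus that part, and \<open>7 / 10 * (U - T) \<le> (U - T) / 2\<close>
    because \<open>U \<le> T\<close>.\<close>
  proof (cases "\<eta>2 \<le> \<eta>3 * k * \<delta>")
    case False
    then have "\<bar>Im \<zeta>\<bar> * q\<^sup>2 / \<delta> \<le> \<eta>2" using par \<delta> by (simp add: k_def divide_le_eq max_def)
    then have "\<beta> * (\<bar>Im \<zeta>\<bar> * q\<^sup>2 / \<delta>) \<le> 9 / 20" using \<beta> \<beta>0 by (meson mult_left_mono order_trans)
    moreover have "0 \<le> \<eta>3 * (k * \<delta>)" using \<eta> k\<delta> by simp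
    ultimately show ?thesis
      using Im_ph kRe k\<delta> \<eta>(1) unfolding decay neg Q_def[symmetric] T_def[symmetric] K_def[symmetric] X_def[symmetric] U_def[symmetric] by argo
  next
    case True
    then have "\<bar>Im \<zeta>\<bar> * q\<^sup>2 / \<delta> \<le> \<eta>3 * (k * \<delta>)"
      using par \<delta> by (simp add: k_def divide_le_eq max_def mult_ac)
    moreover have "\<beta> * (\<bar>Im \<zeta>\<bar> * q\<^sup>2 / \<delta>) \<le> \<bar>Im \<zeta>\<bar> * q\<^sup>2 / \<delta>"
      using \<beta> \<beta>0 \<delta> by (intro mult_left_le_one_le) auto
    moreover have "\<eta>3 * (k * \<delta>) \<le> 1 * (k * \<delta>)" using \<eta> k\<delta> by (intro mult_right_mono) auto
    ultimately show ?thesis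
      using Im_ph kRe \<eta>(1) unfolding decay neg Q_def[symmetric] T_def[symmetric] K_def[symmetric] X_def[symmetric] U_def[symmetric] by argo
  qed
  \<comment> \<open>Follows from \<open>exp 1 \<le> 3\<close>. Thus
    \<open>10 / 7 * exp (1 / 2)\<close> is below 4, and twice this 4 is the 8 in
    \<open>C1\<close>.\<close>
  have half: "exp (1 / 2 :: real) \<le> 2"
  proof (rule power2_le_imp_le)
    show "(exp (1 / 2 :: real))\<^sup>2 \<le> 2\<^sup>2" using exp_le by (simp flip: exp_of_nat_mult exp_double)
  qed simp
  have "norm (G_dir_ext \<zeta> c z p (of_real x + \<tau>)) = exp (- k * Re r + Im \<zeta> * ph) / (4 * pi * norm r)"
    unfolding G_dir_ext_def sqnorm_ext_shift v_def[symmetric] r_def[symmetric]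
    by (simp add: norm_divide norm_mult k_def ph_def v_def inner_add_left algebra_simps flip: exp_add)
  also have "\<dots> \<le> exp (- ((1 - \<eta>3) / 2) * k * \<delta> + (1 / 2 + \<eta>1)) / (4 * pi * (7 / 10 * \<delta>))"
    using exponent Rer complex_Re_le_cmod[of r] \<delta>
    by (intro frac_le mult_left_mono) auto
  also have "\<dots> = (10 / 7 * exp (1 / 2)) * exp \<eta>1 * (exp (- ((1 - \<eta>3) / 2) * k * \<delta>) / (4 * pi * \<delta>))"
  proof -
    have "a * (b * d) / (4 * pi * (7 / 10 * \<delta>)) = 10 / 7 * b * d * (a / (4 * pi * \<delta>))" for a b d
      by simp
    then show ?thesis by (simp only: exp_add)
  qed
  also have "\<dots> \<le> 4 * exp \<eta>1 * (exp (- ((1 - \<eta>3) / 2) * k * \<delta>) / (4 * pi * \<delta>))"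
    using half \<delta> by (intro mult_right_mono) auto
  finally show ?thesis by (simp add: k_def)
qed

text \<open>On the right half-plane \<open>csqrt\<close> is holomorphic and has no zeros.\<close>

lemma G_dir_ext_holomorphic:
  assumes "\<And>t. t \<in> S \<Longrightarrow> 0 < Re (sqnorm_ext z p t)"
  shows "G_dir_ext \<zeta> c z p holomorphic_on S"
proof -
  have w: "sqnorm_ext z p t \<notin> \<real>\<^sub>\<le>\<^sub>0" "sqnorm_ext z p t \<noteq> 0" if "t \<in> S" for t
    using assms[OF that] by (auto simp: complex_nonpos_Reals_iff)
  have hol: "sqnorm_ext z p holomorphic_on S"
    unfolding sqnorm_ext_def[abs_def] by (intro holomorphic_intros)
  then have "(\<lambda>t. csqrt (sqnorm_ext z p t)) holomorphic_on S"
    by (rule holomorphic_on_csqrt') (use w in auto)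
  then show ?thesis
    unfolding G_dir_ext_def[abs_def] by (intro holomorphic_intros) (use w hol in auto)
qed

text \<open>Every point of the stadium is a real parameter plus a small \<open>\<tau>\<close>, so
  the local estimates around real points give holomorphy and one uniform bound on the whole
  stadium.\<close>

lemma G_dir_interp_error:
  fixes z p c M :: "real^3"
  assumes \<zeta>: "0 < Re \<zeta>" and \<eta>: "0 < \<eta>1" "0 < \<eta>2" "0 < \<eta>3" "\<eta>3 < 1"
    and \<delta>: "0 < \<delta>" "\<And>x. \<bar>x\<bar> \<le> 1 \<Longrightarrow> \<delta> \<le> norm (z + x *\<^sub>R p)" "\<delta> \<le> norm M"
    and zM: "\<And>x. \<bar>x\<bar> \<le> 1 \<Longrightarrow> norm (z + x *\<^sub>R p - M) \<le> q"
    and p: "norm p \<le> q / 2" and \<beta>: "0 < \<beta>" "\<beta> \<le> 1" "\<beta> * \<eta>2 \<le> 9 / 20"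
    and q: "0 < q" and q\<delta>: "q \<le> \<eta>2 * \<delta>"
    and dir: "\<bar>Im \<zeta>\<bar> * norm (M /\<^sub>R norm M - c) \<le> \<eta>1 / q"
    and par: "\<bar>Im \<zeta>\<bar> * q\<^sup>2 \<le> max \<eta>2 (\<eta>3 * Re \<zeta> * \<delta>) * \<delta>"
    and x: "-1 \<le> x" "x \<le> 1"
  defines "\<rho> \<equiv> \<beta> + sqrt (1 + \<beta>\<^sup>2)"
  shows "norm (G_dir \<zeta> c (z + x *\<^sub>R p) -
      (\<Sum>i\<le>m. of_real (cheb_lagrange m (-1) 1 i x) * G_dir \<zeta> c (z + cheb_point m i *\<^sub>R p)))
    \<le> (cheb_lebesgue m + 1) * (2 * (4 * exp \<eta>1 *
        (exp (- ((1 - \<eta>3) / 2) * Re \<zeta> * \<delta>) / (4 * pi * \<delta>))) / ((\<rho> - 1) * \<rho> ^ m))"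
proof -
  have small: "norm \<tau> * norm p \<le> 9 / 40 * norm (z + x *\<^sub>R p)" if "\<bar>x\<bar> \<le> 1" "norm \<tau> \<le> \<beta>" for x and \<tau> :: complex
  proof -
    have "norm \<tau> * norm p \<le> \<beta> * (q / 2)" using that p q \<beta> by (intro mult_mono) auto
    also have "\<dots> \<le> \<beta> * (\<eta>2 * \<delta> / 2)" using q\<delta> \<beta> by (intro mult_left_mono) auto
    also have "\<dots> = \<beta> * \<eta>2 * (\<delta> / 2)" by simp
    also have "\<dots> \<le> 9 / 20 * (\<delta> / 2)" using \<beta>(3) \<delta>(1) by (intro mult_right_mono) auto
    also have "\<dots> \<le> 9 / 40 * norm (z + x *\<^sub>R p)" using \<delta>(2)[OF that(1)] by simp
    finally show ?thesis .
  qed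
  have "0 < Re (sqnorm_ext z p t)" if t: "t \<in> stadium \<beta>" for t
  proof -
    obtain x \<tau> where t: "t = of_real x + \<tau>" "\<bar>x\<bar> \<le> 1" "norm \<tau> \<le> \<beta>"
      using t by (auto simp: stadium_def)
    have "z + x *\<^sub>R p \<noteq> 0" using \<delta>(1) \<delta>(2)[OF t(2)] by auto
    then show ?thesis
      unfolding t(1) sqnorm_ext_shift by (rule csqrt_sqnorm_ext_estimates(1)[OF _ small[OF t(2,3)]])
  qed
  then have hol: "G_dir_ext \<zeta> c z p holomorphic_on stadium \<beta>" by (rule G_dir_ext_holomorphic)
  have "norm (G_dir_ext \<zeta> c z p t) \<le> 4 * exp \<eta>1 * (exp (- ((1 - \<eta>3) / 2) * Re \<zeta> * \<delta>) / (4 * pi * \<delta>))"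
    if t: "t \<in> stadium \<beta>" for t
  proof -
    obtain x \<tau> where t: "t = of_real x + \<tau>" "\<bar>x\<bar> \<le> 1" "norm \<tau> \<le> \<beta>"
      using t by (auto simp: stadium_def)
    show ?thesis
      unfolding t(1) by (rule norm_G_dir_ext_le[OF \<zeta> \<eta> \<delta>(1) \<delta>(2)[OF t(2)] \<delta>(3) zM[OF t(2)] p t(3) \<beta>(2,3) q q\<delta> dir par])
  qed
  from cheb_interp_error[OF \<beta>(1) hol this x]
  show ?thesis unfolding G_dir_ext_of_real \<rho>_def .
qed

section \<open>The constants\<close>

lemma beta_hat_bounds:
  assumes "0 < \<eta>2" "0 < \<eta>3" "\<eta>3 < 1"
  shows "0 < beta_hat \<eta>2 \<eta>3" "beta_hat \<eta>2 \<eta>3 \<le> 1" "beta_hat \<eta>2 \<eta>3 * \<eta>2 \<le> 9 / 20"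
proof -
  have "1 < sqrt (3 / 2)" by simp
  moreover have "0 < 2 * sqrt 6 + 5" by (simp add: add_nonneg_pos)
  ultimately show "0 < beta_hat \<eta>2 \<eta>3" using assms by (simp add: beta_hat_def)
  show "beta_hat \<eta>2 \<eta>3 \<le> 1" by (simp add: beta_hat_def)
  have "beta_hat \<eta>2 \<eta>3 \<le> (sqrt (3 / 2) - 1) * (2 / \<eta>2)" unfolding beta_hat_def by (rule Min_le) auto
  then have "beta_hat \<eta>2 \<eta>3 * \<eta>2 \<le> (sqrt (3 / 2) - 1) * 2" using assms by (simp add: field_simps)
  \<comment> \<open>\<open>49 / 40\<close> slightly exceeds \<open>sqrt (3 / 2)\<close>, and
    \<open>2 * (49 / 40 - 1) = 9 / 20\<close>.\<close>
  moreover have "sqrt (3 / 2) \<le> 49 / 40" by (rule real_le_lsqrt) (auto simp: power2_eq_square)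
  ultimately show "beta_hat \<eta>2 \<eta>3 * \<eta>2 \<le> 9 / 20" by argo
qed

lemma alpha_gt_1:
  assumes "0 < beta_hat \<eta>2 \<eta>3"
  shows "1 < alpha \<eta>2 \<eta>3"
proof -
  have "1 < sqrt ((beta_hat \<eta>2 \<eta>3)\<^sup>2 + 1)" using assms by simp
  then show ?thesis using assms by (simp add: alpha_def less_divide_eq)
qed

lemma alpha_times_rho0:
  assumes "0 < beta_hat \<eta>2 \<eta>3"
  shows "alpha \<eta>2 \<eta>3 * rho0 \<eta>2 \<eta>3 = beta_hat \<eta>2 \<eta>3 + sqrt (1 + (beta_hat \<eta>2 \<eta>3)\<^sup>2)"
proof -
  have "beta_hat \<eta>2 \<eta>3 + 1 \<noteq> 0" using assms by simp
  then show ?thesis by (simp add: alpha_def rho0_def add.commute)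
qed

text \<open>A real supremum is known to dominate its members once they are bounded above, which
  holds because the Lebesgue constant grows at most linearly.\<close>

lemma C1_ge:
  assumes "0 < beta_hat \<eta>2 \<eta>3"
  shows "exp \<eta>1 * (8 * (cheb_lebesgue m + 1) / ((rho0 \<eta>2 \<eta>3 - 1) * alpha \<eta>2 \<eta>3 powr (real m / 2)))
    \<le> C1 \<eta>1 \<eta>2 \<eta>3"
proof -
  define b where "b = rho0 \<eta>2 \<eta>3 - 1"
  have b: "b > 0" using assms by (simp add: b_def rho0_def)
  have "\<bar>8 * (cheb_lebesgue m + 1) / b\<bar> \<le> 24 / b * real (m + 1) ^ 1" for m
  proof -
    \<comment> \<open>\<open>cheb_lebesgue m + 1\<close> is at most \<open>2 * (m + 1) + 1\<close>,
      hence at most \<open>3 * (m + 1)\<close>.\<close>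
    have "8 * (cheb_lebesgue m + 1) \<le> 24 * real (m + 1)" using cheb_lebesgue_le[of m] by simp
    then show ?thesis using b cheb_lebesgue_ge_1[of m] by (simp add: divide_right_mono)
  qed
  from bdd_above_polynomial_over_powr[OF alpha_gt_1[OF assms] this]
  have "bdd_above (range (\<lambda>m. 8 * (cheb_lebesgue m + 1) / (b * alpha \<eta>2 \<eta>3 powr (real m / 2))))"
    by (simp add: divide_divide_eq_left)
  then show ?thesis
    unfolding C1_def b_def by (intro mult_left_mono cSUP_upper) auto
qed

lemma C0_ge:
  assumes "0 < beta_hat \<eta>2 \<eta>3"
  shows "6 * (cheb_lebesgue m ^ 5 / alpha \<eta>2 \<eta>3 powr (real m / 2)) * C1 \<eta>1 \<eta>2 \<eta>3 \<le> C0 \<eta>1 \<eta>2 \<eta>3"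
    and "0 < C1 \<eta>1 \<eta>2 \<eta>3" and "0 < C0 \<eta>1 \<eta>2 \<eta>3"
proof -
  have \<alpha>: "0 < alpha \<eta>2 \<eta>3" using alpha_gt_1[OF assms] by simp
  have \<Lambda>: "0 < cheb_lebesgue m" for m using cheb_lebesgue_ge_1[of m] by linarith
  \<comment> \<open>The member with \<open>m = 0\<close> is positive, hence so is the
    supremum.\<close>
  have "0 < exp \<eta>1 * (8 * (cheb_lebesgue 0 + 1) / ((rho0 \<eta>2 \<eta>3 - 1) * alpha \<eta>2 \<eta>3 powr (real 0 / 2)))"
    using assms \<alpha> \<Lambda>[of 0] by (simp add: rho0_def)
  then show C1: "0 < C1 \<eta>1 \<eta>2 \<eta>3" using C1_ge[OF assms, of \<eta>1 0] by linarith
  \<comment> \<open>\<open>192 = 6 * 2 ^ 5\<close>, from the fifth power of the linear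
    bound.\<close>
  have "\<bar>6 * cheb_lebesgue m ^ 5 * C1 \<eta>1 \<eta>2 \<eta>3\<bar> \<le> 192 * C1 \<eta>1 \<eta>2 \<eta>3 * real (m + 1) ^ 5" for m
  proof -
    have "cheb_lebesgue m ^ 5 \<le> (2 * real (m + 1)) ^ 5"
      using cheb_lebesgue_le[of m] \<Lambda>[of m] by (intro power_mono) auto
    also have "\<dots> = 32 * real (m + 1) ^ 5" unfolding power_mult_distrib by simp
    finally have "6 * cheb_lebesgue m ^ 5 * C1 \<eta>1 \<eta>2 \<eta>3 \<le> 6 * (32 * real (m + 1) ^ 5) * C1 \<eta>1 \<eta>2 \<eta>3"
      using C1 by (intro mult_right_mono mult_left_mono) auto
    then show ?thesis using C1 \<Lambda>[of m] by (simp add: abs_mult mult_ac)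
  qed
  from bdd_above_polynomial_over_powr[OF alpha_gt_1[OF assms] this]
  have "bdd_above (range (\<lambda>m. 6 * (cheb_lebesgue m ^ 5 / alpha \<eta>2 \<eta>3 powr (real m / 2)) * C1 \<eta>1 \<eta>2 \<eta>3))"
    by simp
  then show ge: "6 * (cheb_lebesgue m ^ 5 / alpha \<eta>2 \<eta>3 powr (real m / 2)) * C1 \<eta>1 \<eta>2 \<eta>3 \<le> C0 \<eta>1 \<eta>2 \<eta>3" for m
    unfolding C0_def by (intro cSUP_upper) auto
  have "0 < 6 * (cheb_lebesgue 0 ^ 5 / alpha \<eta>2 \<eta>3 powr (real 0 / 2)) * C1 \<eta>1 \<eta>2 \<eta>3"
    using \<alpha> \<Lambda>[of 0] C1 by simp
  then show "0 < C0 \<eta>1 \<eta>2 \<eta>3" using ge[of 0] by linarith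
qed

text \<open>The factor \<open>\<alpha>\<^sup>m\<close> in \<open>\<rho>\<^sup>m = \<alpha>\<^sup>m \<rho>\<^sub>0\<^sup>m\<close> is split evenly between \<open>C1\<close> and \<open>C0\<close>.\<close>

lemma error_constant_le:
  assumes "0 < beta_hat \<eta>2 \<eta>3" "0 \<le> B"
  defines "\<rho> \<equiv> beta_hat \<eta>2 \<eta>3 + sqrt (1 + (beta_hat \<eta>2 \<eta>3)\<^sup>2)"
  shows "6 * cheb_lebesgue m ^ 5 * ((cheb_lebesgue m + 1) * (2 * (4 * exp \<eta>1 * B) / ((\<rho> - 1) * \<rho> ^ m)))
    \<le> C0 \<eta>1 \<eta>2 \<eta>3 * B * (1 / rho0 \<eta>2 \<eta>3 ^ m)"
proof -
  define \<Lambda> where "\<Lambda> = cheb_lebesgue m"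
  define P where "P = alpha \<eta>2 \<eta>3 powr (real m / 2)"
  define r where "r = rho0 \<eta>2 \<eta>3"
  have \<alpha>: "1 < alpha \<eta>2 \<eta>3" by (rule alpha_gt_1[OF assms(1)])
  have \<Lambda>: "1 \<le> \<Lambda>" unfolding \<Lambda>_def by (rule cheb_lebesgue_ge_1)
  have r: "1 < r" using assms(1) by (simp add: r_def rho0_def)
  have P: "0 < P" using \<alpha> by (simp add: P_def)
  have \<rho>: "\<rho> = alpha \<eta>2 \<eta>3 * r" using alpha_times_rho0[OF assms(1)] by (simp add: \<rho>_def r_def)
  have "P * P = alpha \<eta>2 \<eta>3 ^ m"
    using \<alpha> by (simp add: P_def powr_realpow flip: powr_add)
  then have \<rho>m: "\<rho> ^ m = P * P * r ^ m" by (simp add: \<rho> power_mult_distrib)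
  \<comment> \<open>Since \<open>alpha\<close> exceeds 1, replacing \<open>\<rho> - 1\<close> by the
    \<open>rho0 - 1\<close> of \<open>C1\<close> only enlarges the quotient.\<close>
  have "1 * r \<le> \<rho>" unfolding \<rho> using \<alpha> r by (intro mult_right_mono) auto
  then have "2 * (4 * exp \<eta>1 * B) / ((\<rho> - 1) * \<rho> ^ m) \<le> 2 * (4 * exp \<eta>1 * B) / ((r - 1) * (P * P * r ^ m))"
    unfolding \<rho>m using r P assms(2) by (intro divide_left_mono mult_right_mono mult_pos_pos) auto
  then have "6 * \<Lambda> ^ 5 * ((\<Lambda> + 1) * (2 * (4 * exp \<eta>1 * B) / ((\<rho> - 1) * \<rho> ^ m))) \<le>
      6 * \<Lambda> ^ 5 * ((\<Lambda> + 1) * (2 * (4 * exp \<eta>1 * B) / ((r - 1) * (P * P * r ^ m))))"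
    using \<Lambda> by (intro mult_left_mono) auto
  also have "\<dots> = 6 * (\<Lambda> ^ 5 / P) * (exp \<eta>1 * (8 * (\<Lambda> + 1) / ((r - 1) * P))) * B * (1 / r ^ m)"
    using P r by (simp add: field_simps)
  also have "\<dots> \<le> 6 * (\<Lambda> ^ 5 / P) * C1 \<eta>1 \<eta>2 \<eta>3 * B * (1 / r ^ m)"
    using C1_ge[OF assms(1), of \<eta>1 m] \<Lambda> P r assms(2) unfolding \<Lambda>_def[symmetric] P_def[symmetric] r_def[symmetric]
    by (intro mult_right_mono mult_left_mono) auto
  also have "\<dots> \<le> C0 \<eta>1 \<eta>2 \<eta>3 * B * (1 / r ^ m)"
    using C0_ge(1)[OF assms(1), of m \<eta>1] r assms(2) unfolding \<Lambda>_def[symmetric] P_def[symmetric]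
    by (intro mult_right_mono) auto
  finally show ?thesis by (simp add: \<Lambda>_def r_def)
qed

section \<open>The directional interpolant\<close>

lemma norm_diff_midpoint_le:
  fixes l u x :: "'a::euclidean_space"
  assumes "x \<in> cbox l u"
  shows "norm (x - midpoint l u) \<le> norm (u - l) / 2"
proof -
  have "norm (x - midpoint l u) \<le> norm ((1 / 2) *\<^sub>R (u - l))"
  proof (rule norm_le_componentwise)
    fix k :: 'a assume "k \<in> Basis"
    then have "l \<bullet> k \<le> x \<bullet> k" "x \<bullet> k \<le> u \<bullet> k" using assms by (auto simp: mem_box)
    then show "\<bar>(x - midpoint l u) \<bullet> k\<bar> \<le> \<bar>((1 / 2) *\<^sub>R (u - l)) \<bullet> k\<bar>"
      by (simp add: midpoint_def inner_diff_left inner_add_left field_simps abs_le_iff)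
  qed
  then show ?thesis by simp
qed

theorem theorem4p2:
  fixes \<zeta> :: complex and \<eta>1 \<eta>2 \<eta>3 :: real
    and c lt ut ls us Mt Ms :: "real^3" and Bt Bs :: "(real^3) set"
  assumes "Re \<zeta> > 0"
    and "\<eta>1 > 0" and "\<eta>2 > 0" and "0 < \<eta>3" and "\<eta>3 < 1"
    and "norm c = 1"
    and "\<forall>k. lt $ k < ut $ k" and "\<forall>k. ls $ k < us $ k"
    and "Bt = cbox lt ut" and "Bs = cbox ls us"
    and "Mt = midpoint lt ut" and "Ms = midpoint ls us"
    and "\<bar>Im \<zeta>\<bar> * norm ((1 / norm (Mt - Ms)) *\<^sub>R (Mt - Ms) - c)
           \<le> \<eta>1 / max (diameter Bt) (diameter Bs)"
    and "max (diameter Bt) (diameter Bs) \<le> \<eta>2 * setdist Bt Bs"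
    and "\<bar>Im \<zeta>\<bar> * max ((diameter Bt)\<^sup>2) ((diameter Bs)\<^sup>2)
           \<le> max \<eta>2 (\<eta>3 * Re \<zeta> * setdist Bt Bs) * setdist Bt Bs"
  shows "C0 \<eta>1 \<eta>2 \<eta>3 > 0 \<and> rho0 \<eta>2 \<eta>3 > 1 \<and>
    (\<forall>m::nat.
      (SUP (x, y)\<in>Bt \<times> Bs. ereal (cmod (G \<zeta> (x - y) - G_approx \<zeta> c m lt ut ls us x y)))
        \<le> ereal (C0 \<eta>1 \<eta>2 \<eta>3 * exp (- ((1 - \<eta>3) / 2) * Re \<zeta> * setdist Bt Bs)
                   / (4 * pi * setdist Bt Bs) * (1 / rho0 \<eta>2 \<eta>3 ^ m)))"
proof (intro conjI allI)
  define \<delta> where "\<delta> = setdist Bt Bs"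
  define q where "q = max (diameter Bt) (diameter Bs)"
  define M where "M = Mt - Ms"
  define \<beta> where "\<beta> = beta_hat \<eta>2 \<eta>3"
  define \<rho> where "\<rho> = \<beta> + sqrt (1 + \<beta>\<^sup>2)"
  define B where "B = exp (- ((1 - \<eta>3) / 2) * Re \<zeta> * \<delta>) / (4 * pi * \<delta>)"
  note \<beta> = beta_hat_bounds[OF assms(3-5), folded \<beta>_def]
  show "C0 \<eta>1 \<eta>2 \<eta>3 > 0" using C0_ge(3) \<beta>(1) by (simp add: \<beta>_def)
  show "rho0 \<eta>2 \<eta>3 > 1" using \<beta>(1) by (simp add: rho0_def \<beta>_def)
  fix m :: nat
  have lt: "lt \<bullet> k < ut \<bullet> k" and ls: "ls \<bullet> k < us \<bullet> k" if "k \<in> Basis" for k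
    using that assms(7,8) by (auto simp: Basis_vec_def inner_axis)
  have diam: "diameter Bt = norm (ut - lt)" "diameter Bs = norm (us - ls)"
    unfolding assms(9,10) using lt ls
    by (subst diameter_cbox; force simp: dist_norm norm_minus_commute less_imp_le)+
  have "lt \<noteq> ut" using assms(7) by auto
  then have q: "0 < q" by (simp add: q_def diam less_max_iff_disj)
  have q\<delta>: "q \<le> \<eta>2 * \<delta>" using assms(14) by (simp add: q_def \<delta>_def)
  \<comment> \<open>A positive diameter and the second admissibility condition force a positive
    distance, so the kernel has no singularity on the pair of boxes.\<close>
  then have \<delta>: "0 < \<delta>" using q assms(3) by (metis less_le_trans zero_less_mult_pos)
  have dir: "\<bar>Im \<zeta>\<bar> * norm (M /\<^sub>R norm M - c) \<le> \<eta>1 / q"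
    using assms(13) by (simp add: M_def q_def inverse_eq_divide)
  have "0 \<le> diameter Bt" "0 \<le> diameter Bs" by (simp_all add: diam)
  then have "max ((diameter Bt)\<^sup>2) ((diameter Bs)\<^sup>2) = q\<^sup>2"
    unfolding q_def by (auto simp: max_def power_mono_iff)
  then have par: "\<bar>Im \<zeta>\<bar> * q\<^sup>2 \<le> max \<eta>2 (\<eta>3 * Re \<zeta> * \<delta>) * \<delta>"
    using assms(15) by (simp add: \<delta>_def)
  have dist: "\<delta> \<le> norm (x - y)" if "x \<in> Bt" "y \<in> Bs" for x y
    using setdist_le_dist[OF that] by (simp add: \<delta>_def dist_norm)
  have Mts: "Mt \<in> Bt" "Ms \<in> Bs"
    unfolding assms(9-12) mem_box using lt ls
    by (auto simp: midpoint_def inner_add_left field_simps intro: less_imp_le)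
  \<comment> \<open>Each point is within half a diameter of its center, so the two deviations add up
    to at most \<open>q\<close>.\<close>
  have center: "norm (x - y - M) \<le> q" if "x \<in> Bt" "y \<in> Bs" for x y
  proof -
    have "norm (x - y - M) \<le> norm (x - Mt) + norm (y - Ms)"
      using norm_triangle_ineq4[of "x - Mt" "y - Ms"] by (simp add: M_def algebra_simps)
    also have "\<dots> \<le> diameter Bt / 2 + diameter Bs / 2"
      unfolding diam using that norm_diff_midpoint_le assms(9-12) by (intro add_mono) auto
    also have "\<dots> \<le> q" by (simp add: q_def)
    finally show ?thesis .
  qed
  define l u where "l = (lt, ls)" and "u = (ut, us)"
  define f where "f = (\<lambda>(x', y'). G_dir \<zeta> c (x' - y'))"
  have lu: "l \<bullet> k < u \<bullet> k" if "k \<in> Basis" for k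
    using that lt ls by (auto simp: l_def u_def Basis_prod_def)
  have box: "w \<in> cbox l u \<longleftrightarrow> fst w \<in> Bt \<and> snd w \<in> Bs" for w
    by (cases w) (simp add: l_def u_def assms(9,10))
  define E where "E = (cheb_lebesgue m + 1) * (2 * (4 * exp \<eta>1 * B) / ((\<rho> - 1) * \<rho> ^ m))"
  have err: "norm (f w - (\<Sum>i\<le>m. of_real (cheb_lagrange m (l \<bullet> k) (u \<bullet> k) i (w \<bullet> k)) *
        f (w + (cheb_node m (l \<bullet> k) (u \<bullet> k) i - w \<bullet> k) *\<^sub>R k))) \<le> E"
    if w: "w \<in> cbox l u" and k: "k \<in> Basis" for w k
  proof -
    \<comment> \<open>On the coordinate line through \<open>w\<close> in direction \<open>k\<close>
      that coordinate is \<open>a + h * t\<close>, and the difference of the two components runs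
      along \<open>z + t p\<close>. The vector \<open>v\<close> is plus or minus a standard unit
      vector, because \<open>k\<close> moves only one of the two points.\<close>
    define a h where "a = (l \<bullet> k + u \<bullet> k) / 2" and "h = (u \<bullet> k - l \<bullet> k) / 2"
    define v where "v = fst k - snd k"
    define z where "z = fst w - snd w + (a - w \<bullet> k) *\<^sub>R v"
    define p where "p = h *\<^sub>R v"
    have h: "0 < h" using lu[OF k] by (simp add: h_def)
    have line: "f (w + (a + h * t - w \<bullet> k) *\<^sub>R k) = G_dir \<zeta> c (z + t *\<^sub>R p)" for t
      by (simp add: f_def case_prod_unfold z_def p_def v_def algebra_simps)
    have "norm v = 1" using k by (auto simp: v_def Basis_prod_def)
    have in_box: "w + (a + h * t - w \<bullet> k) *\<^sub>R k \<in> cbox l u" if "\<bar>t\<bar> \<le> 1" for t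
    proof -
      have "\<bar>h * t\<bar> \<le> h" using that h by (simp add: abs_mult mult_left_le)
      then have "l \<bullet> k \<le> a + h * t" "a + h * t \<le> u \<bullet> k"
        unfolding a_def h_def abs_le_iff by argo+
      then show ?thesis using w k by (auto simp: mem_box inner_add_left inner_Basis)
    qed
    have diff: "z + t *\<^sub>R p = fst (w + (a + h * t - w \<bullet> k) *\<^sub>R k) - snd (w + (a + h * t - w \<bullet> k) *\<^sub>R k)" for t
      by (simp add: z_def p_def v_def algebra_simps)
    \<comment> \<open>\<open>2 * h\<close> is a side length of one of the boxes, hence at most its
      diameter.\<close>
    have "2 * h \<le> q"
    proof -
      consider e where "e \<in> Basis" "k = (e, 0)" | e where "e \<in> Basis" "k = (0, e)"
        using k by (auto simp: Basis_prod_def)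
      then show ?thesis
      proof cases
        case 1
        then show ?thesis
          using Basis_le_norm[of e "ut - lt"] by (simp add: h_def l_def u_def q_def diam inner_diff_left)
      next
        case 2
        then show ?thesis
          using Basis_le_norm[of e "us - ls"] by (simp add: h_def l_def u_def q_def diam inner_diff_left)
      qed
    qed
    then have p: "norm p \<le> q / 2" using \<open>norm v = 1\<close> h by (simp add: p_def)
    obtain t where t: "-1 \<le> t" "t \<le> 1" and wt: "w \<bullet> k = a + h * t"
      using affine_parameter[OF lu[OF k], of "w \<bullet> k"] w k by (auto simp: a_def h_def mem_box)
    have "norm (G_dir \<zeta> c (z + t *\<^sub>R p) -
        (\<Sum>i\<le>m. of_real (cheb_lagrange m (-1) 1 i t) * G_dir \<zeta> c (z + cheb_point m i *\<^sub>R p))) \<le> E"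
      unfolding E_def B_def \<rho>_def
    proof (rule G_dir_interp_error[OF assms(1-5) \<delta> _ _ _ p \<beta> q q\<delta> dir par t])
      show "\<delta> \<le> norm (z + x *\<^sub>R p)" if "\<bar>x\<bar> \<le> 1" for x
        unfolding diff using in_box[OF that] unfolding box by (auto intro!: dist)
      show "norm (z + x *\<^sub>R p - M) \<le> q" if "\<bar>x\<bar> \<le> 1" for x
        unfolding diff using in_box[OF that] unfolding box by (auto intro!: center)
      show "\<delta> \<le> norm M" unfolding M_def by (intro dist Mts)
    qed
    moreover have "cheb_lagrange m (l \<bullet> k) (u \<bullet> k) i (w \<bullet> k) = cheb_lagrange m (-1) 1 i t" for i
      unfolding wt a_def h_def by (rule cheb_lagrange_affine[OF lu[OF k]])
    moreover have "f w = G_dir \<zeta> c (z + t *\<^sub>R p)" using line[of t] by (simp add: wt)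
    moreover have "f (w + (cheb_node m (l \<bullet> k) (u \<bullet> k) i - w \<bullet> k) *\<^sub>R k) =
        G_dir \<zeta> c (z + cheb_point m i *\<^sub>R p)" for i
      using line[of "cheb_point m i"] by (simp add: cheb_node_def a_def h_def)
    ultimately show ?thesis by simp
  qed
  have main: "norm (G \<zeta> (x - y) - G_approx \<zeta> c m lt ut ls us x y)
      \<le> C0 \<eta>1 \<eta>2 \<eta>3 * B * (1 / rho0 \<eta>2 \<eta>3 ^ m)" if "x \<in> Bt" "y \<in> Bs" for x y
  proof -
    \<comment> \<open>The plane wave is a common factor of kernel and approximation and has modulus
      1.\<close>
    have "G \<zeta> (x - y) - G_approx \<zeta> c m lt ut ls us x y =
      exp (- \<i> * of_real (Im \<zeta> * ((x - y) \<bullet> c))) * (f (x, y) - tensor_cheb_interp m l u f (x, y))"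
      unfolding G_eq_G_dir[of _ _ c] G_approx_def f_def l_def u_def prod.case right_diff_distrib ..
    moreover have "norm (exp (- \<i> * complex_of_real (Im \<zeta> * ((x - y) \<bullet> c)))) = 1" by simp
    ultimately have "norm (G \<zeta> (x - y) - G_approx \<zeta> c m lt ut ls us x y) =
      norm (f (x, y) - tensor_cheb_interp m l u f (x, y))"
      by (simp only: norm_mult mult_1_left)
    also have "\<dots> \<le> real DIM((real^3) \<times> (real^3)) * cheb_lebesgue m ^ (DIM((real^3) \<times> (real^3)) - 1) * E"
      by (rule tensor_cheb_interp_error[OF lu _ err]) (use that in \<open>simp_all add: box\<close>)
    \<comment> \<open>The product of the boxes has dimension 6, which yields the factor 6 and the
      fifth power in \<open>C0\<close>.\<close>
    also have "\<dots> = 6 * cheb_lebesgue m ^ 5 * E" by simp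
    also have "\<dots> \<le> C0 \<eta>1 \<eta>2 \<eta>3 * B * (1 / rho0 \<eta>2 \<eta>3 ^ m)"
      unfolding E_def \<rho>_def \<beta>_def
      by (rule error_constant_le) (use \<beta>(1) \<delta> in \<open>simp_all add: \<beta>_def B_def\<close>)
    finally show ?thesis .
  qed
  show "(SUP (x, y)\<in>Bt \<times> Bs. ereal (cmod (G \<zeta> (x - y) - G_approx \<zeta> c m lt ut ls us x y)))
        \<le> ereal (C0 \<eta>1 \<eta>2 \<eta>3 * exp (- ((1 - \<eta>3) / 2) * Re \<zeta> * setdist Bt Bs)
                   / (4 * pi * setdist Bt Bs) * (1 / rho0 \<eta>2 \<eta>3 ^ m))"
    using main by (intro SUP_least) (auto simp: B_def \<delta>_def)
qed

end
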